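(* Let $0<a_0\le a(x)\le a_1$ on $(0,1)$, and let $V_h\subset H^1(0,1)$ and $Q_h\subset L^2(0,1)$ be finite-dimensional subspaces with $Q_h=\partial_x V_h$ and $1\in V_h$. Let $T>0$, $u_0,p_0\in L^2(0,1)$, and let $(u_h,p_h)\in H^1(0,T;V_h\times Q_h)$ satisfy $u_h(0)=\pi_hu_0$, $p_h(0)=\rho_hp_0$ and, for a.e. $t\in(0,T)$, $$(\partial_t u_h(t),\bar v_h)-(p_h(t),\partial_x\bar v_h)+(a u_h(t),\bar v_h)=0\quad\text{for all }\bar v_h\in V_h,$$ $$(\partial_t p_h(t),\bar q_h)+(\partial_x u_h(t),\bar q_h)=0\quad\text{for all }\bar q_h\in Q_h.$$ Then for every integer $k\ge0$ and all $0\le s\le t\le T$, $$E_h^k(t)\le 3\,e^{-\alpha(t-s)}E_h^k(s),\qquad \alpha=\frac43\,\frac{a_0^3}{8a_0^2+4a_0^2a_1+2a_0a_1+a_1^4}>0,$$ where $E_h^k(t)=\frac12\big(\|\partial_t^k u_h(t)\|^2+\|\partial_t^k p_h(t)\|^2\big)$.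
   Context: $(\cdot,\cdot)$ and $\|\cdot\|$ are the scalar product and norm of $L^2(0,1)$; $\partial_xV_h=\{\partial_x v:v\in V_h\}$ and $1$ denotes the constant function. $\pi_h:L^2(0,1)\to V_h$ and $\rho_h:L^2(0,1)\to Q_h$ are the $L^2$-orthogonal projections. (Semi-discrete solutions are infinitely differentiable in time, so all $E_h^k$ are well defined.) *)

theory Defs
  imports "HOL-Analysis.Analysis"
begin

section \<open>Square-integrable functions on an interval and weak derivatives\<close>

definition square_integrable ::
    "real \<Rightarrow> real \<Rightarrow> (real \<Rightarrow> 'a::real_normed_vector) \<Rightarrow> bool"
  where "square_integrable a b f \<longleftrightarrow>
    f \<in> borel_measurable (lebesgue_on {a<..<b}) \<and>
    integrable (lebesgue_on {a<..<b}) (\<lambda>x. (norm (f x))\<^sup>2)"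

definition test_function :: "real \<Rightarrow> real \<Rightarrow> (real \<Rightarrow> real) \<Rightarrow> bool"
  where "test_function a b \<phi> \<longleftrightarrow>
    (\<forall>k. (deriv ^^ k) \<phi> differentiable_on UNIV) \<and>
    (\<exists>K. compact K \<and> K \<subseteq> {a<..<b} \<and> (\<forall>x. x \<notin> K \<longrightarrow> \<phi> x = 0))"

text \<open>
  The vector-valued identity "integral of \<open>\<phi>' f\<close> equals minus integral of \<open>\<phi> g\<close>" on \<open>(a,b)\<close>.
  The gauge integral is used because it is available for values in any normed space. It is
  only applied to square-integrable functions whose values lie in a finite-dimensional space;
  there it is the Lebesgue (Bochner) integral.  The values at \<open>a\<close> and \<open>b\<close> do not matter.
\<close>

definition weak_derivative ::
    "real \<Rightarrow> real \<Rightarrow> (real \<Rightarrow> 'a::real_normed_vector) \<Rightarrow> (real \<Rightarrow> 'a) \<Rightarrow> bool"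
  where "weak_derivative a b f g \<longleftrightarrow>
    (\<forall>\<phi>. test_function a b \<phi> \<longrightarrow>
      (\<exists>I. ((\<lambda>x. deriv \<phi> x *\<^sub>R f x) has_integral I) {a..b} \<and>
           ((\<lambda>x. \<phi> x *\<^sub>R g x) has_integral - I) {a..b}))"


section \<open>The inner product space \<open>L\<^sup>2(0,1)\<close>\<close>

abbreviation unit_measure :: "real measure"
  where "unit_measure \<equiv> lebesgue_on {0<..<1}"

definition ae_eq :: "(real \<Rightarrow> real) \<Rightarrow> (real \<Rightarrow> real) \<Rightarrow> bool"
  where "ae_eq f g \<longleftrightarrow> square_integrable 0 1 f \<and> square_integrable 0 1 g \<and>
    (AE x in unit_measure. f x = g x)"

lemma square_integrable_mult:
  fixes f g :: "real \<Rightarrow> real"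
  assumes "square_integrable a b f" "square_integrable a b g"
  shows "integrable (lebesgue_on {a<..<b}) (\<lambda>x. f x * g x)"
proof -
  have f: "f \<in> borel_measurable (lebesgue_on {a<..<b})"
    and g: "g \<in> borel_measurable (lebesgue_on {a<..<b})"
    and i: "integrable (lebesgue_on {a<..<b}) (\<lambda>x. (f x)\<^sup>2 + (g x)\<^sup>2)"
    using assms by (auto simp: square_integrable_def)
  show ?thesis
  proof (rule Bochner_Integration.integrable_bound[OF i])
    show "(\<lambda>x. f x * g x) \<in> borel_measurable (lebesgue_on {a<..<b})"
      using f g by measurable
    have "norm (f x * g x) \<le> norm ((f x)\<^sup>2 + (g x)\<^sup>2)" for x
    proof -
      have "2 * (\<bar>f x\<bar> * \<bar>g x\<bar>) \<le> (f x)\<^sup>2 + (g x)\<^sup>2"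
        using sum_squares_bound[of "\<bar>f x\<bar>" "\<bar>g x\<bar>"] by simp
      moreover have "0 \<le> \<bar>f x\<bar> * \<bar>g x\<bar>" by simp
      ultimately have "\<bar>f x\<bar> * \<bar>g x\<bar> \<le> (f x)\<^sup>2 + (g x)\<^sup>2" by linarith
      then show ?thesis by (simp add: abs_mult)
    qed
    then show "AE x in lebesgue_on {a<..<b}. norm (f x * g x) \<le> norm ((f x)\<^sup>2 + (g x)\<^sup>2)"
      by simp
  qed
qed

lemma square_integrable_zero: "square_integrable a b (\<lambda>x. 0 :: real)"
  by (simp add: square_integrable_def)

lemma square_integrable_scale:
  fixes f :: "real \<Rightarrow> real"
  assumes "square_integrable a b f"
  shows "square_integrable a b (\<lambda>x. c * f x)"
  using assms by (auto simp: square_integrable_def power_mult_distrib)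

lemma square_integrable_add:
  fixes f g :: "real \<Rightarrow> real"
  assumes "square_integrable a b f" "square_integrable a b g"
  shows "square_integrable a b (\<lambda>x. f x + g x)"
proof -
  have "integrable (lebesgue_on {a<..<b}) (\<lambda>x. (f x)\<^sup>2 + (g x)\<^sup>2 + 2 * (f x * g x))"
    using assms square_integrable_mult[OF assms]
    by (auto simp: square_integrable_def)
  then show ?thesis
    using assms by (auto simp: square_integrable_def power2_sum mult.assoc)
qed

lemma square_integrable_uminus:
  fixes f :: "real \<Rightarrow> real"
  assumes "square_integrable a b f"
  shows "square_integrable a b (\<lambda>x. - f x)"
  using square_integrable_scale[OF assms, of "-1"] by simp

lemma square_integrable_diff:
  fixes f g :: "real \<Rightarrow> real"
  assumes "square_integrable a b f" "square_integrable a b g"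
  shows "square_integrable a b (\<lambda>x. f x - g x)"
  using square_integrable_add[OF assms(1) square_integrable_uminus[OF assms(2)]] by simp

lemma part_equivp_ae_eq: "part_equivp ae_eq"
proof (rule part_equivpI)
  show "\<exists>f. ae_eq f f"
    by (intro exI[of _ "\<lambda>x. 0"]) (simp add: ae_eq_def square_integrable_zero)
  show "symp ae_eq"
    by (auto intro!: sympI simp: ae_eq_def elim: eventually_mono)
  show "transp ae_eq"
  proof (rule transpI)
    fix f g h :: "real \<Rightarrow> real"
    assume *: "ae_eq f g" "ae_eq g h"
    then have "AE x in unit_measure. f x = g x" "AE x in unit_measure. g x = h x"
      by (auto simp: ae_eq_def)
    then have "AE x in unit_measure. f x = h x" by eventually_elim simp
    with * show "ae_eq f h" by (simp add: ae_eq_def)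
  qed
qed

quotient_type L2 = "real \<Rightarrow> real" / partial: ae_eq
  by (rule part_equivp_ae_eq)

instantiation L2 :: real_inner
begin

lift_definition zero_L2 :: L2 is "\<lambda>x. 0"
  by (simp add: ae_eq_def square_integrable_zero)

lift_definition plus_L2 :: "L2 \<Rightarrow> L2 \<Rightarrow> L2" is "\<lambda>f g x. f x + g x"
proof -
  fix f f' g g' :: "real \<Rightarrow> real"
  assume *: "ae_eq f f'" "ae_eq g g'"
  then have "AE x in unit_measure. f x = f' x" "AE x in unit_measure. g x = g' x"
    by (auto simp: ae_eq_def)
  then have "AE x in unit_measure. f x + g x = f' x + g' x" by eventually_elim simp
  with * show "ae_eq (\<lambda>x. f x + g x) (\<lambda>x. f' x + g' x)"
    by (simp add: ae_eq_def square_integrable_add)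
qed

lift_definition minus_L2 :: "L2 \<Rightarrow> L2 \<Rightarrow> L2" is "\<lambda>f g x. f x - g x"
proof -
  fix f f' g g' :: "real \<Rightarrow> real"
  assume *: "ae_eq f f'" "ae_eq g g'"
  then have "AE x in unit_measure. f x = f' x" "AE x in unit_measure. g x = g' x"
    by (auto simp: ae_eq_def)
  then have "AE x in unit_measure. f x - g x = f' x - g' x" by eventually_elim simp
  with * show "ae_eq (\<lambda>x. f x - g x) (\<lambda>x. f' x - g' x)"
    by (simp add: ae_eq_def square_integrable_diff)
qed

lift_definition uminus_L2 :: "L2 \<Rightarrow> L2" is "\<lambda>f x. - f x"
  by (auto simp: ae_eq_def square_integrable_uminus elim: eventually_mono)

lift_definition scaleR_L2 :: "real \<Rightarrow> L2 \<Rightarrow> L2" is "\<lambda>c f x. c * f x"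
  by (auto simp: ae_eq_def square_integrable_scale elim: eventually_mono)

lift_definition inner_L2 :: "L2 \<Rightarrow> L2 \<Rightarrow> real" is
  "\<lambda>f g. LINT x|unit_measure. f x * g x"
proof -
  fix f f' g g' :: "real \<Rightarrow> real"
  assume *: "ae_eq f f'" "ae_eq g g'"
  then have "AE x in unit_measure. f x = f' x" "AE x in unit_measure. g x = g' x"
    by (auto simp: ae_eq_def)
  then have "AE x in unit_measure. f x * g x = f' x * g' x" by eventually_elim simp
  moreover have "(\<lambda>x. f x * g x) \<in> borel_measurable unit_measure"
    "(\<lambda>x. f' x * g' x) \<in> borel_measurable unit_measure"
    using * by (auto simp: ae_eq_def square_integrable_def)
  ultimately show "(LINT x|unit_measure. f x * g x) = (LINT x|unit_measure. f' x * g' x)"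
    by (intro integral_cong_AE) auto
qed

definition norm_L2 :: "L2 \<Rightarrow> real"
  where "norm_L2 u = sqrt (inner u u)"

definition dist_L2 :: "L2 \<Rightarrow> L2 \<Rightarrow> real"
  where "dist_L2 u v = norm (u - v)"

definition sgn_L2 :: "L2 \<Rightarrow> L2"
  where "sgn_L2 u = inverse (norm u) *\<^sub>R u"

definition uniformity_L2 :: "(L2 \<times> L2) filter"
  where "uniformity_L2 = (INF e\<in>{0<..}. principal {(x, y). dist x y < e})"

definition open_L2 :: "L2 set \<Rightarrow> bool"
  where "open_L2 U = (\<forall>x\<in>U. eventually (\<lambda>(x', y). x' = x \<longrightarrow> y \<in> U) uniformity)"

instance
proof
  fix u v w :: L2 and c d :: real and U :: "L2 set"
  show "u + v + w = u + (v + w)"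
    by transfer (auto simp: ae_eq_def square_integrable_add add.assoc)
  show "u + v = v + u"
    by transfer (auto simp: ae_eq_def square_integrable_add add.commute)
  show "0 + u = u"
    by transfer (auto simp: ae_eq_def)
  show "- u + u = 0"
    by transfer (auto simp: ae_eq_def square_integrable_zero)
  show "u - v = u + - v"
    by transfer (auto simp: ae_eq_def square_integrable_diff)
  show "c *\<^sub>R (u + v) = c *\<^sub>R u + c *\<^sub>R v"
    by transfer (auto simp: ae_eq_def square_integrable_scale square_integrable_add distrib_left)
  show "(c + d) *\<^sub>R u = c *\<^sub>R u + d *\<^sub>R u"
    by transfer (auto simp: ae_eq_def square_integrable_scale square_integrable_add distrib_right)
  show "c *\<^sub>R d *\<^sub>R u = (c * d) *\<^sub>R u"
    by transfer (auto simp: ae_eq_def square_integrable_scale mult.assoc)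
  show "1 *\<^sub>R u = u"
    by transfer (auto simp: ae_eq_def)
  show "sgn u = inverse (norm u) *\<^sub>R u"
    by (simp add: sgn_L2_def)
  show "dist u v = norm (u - v)"
    by (rule dist_L2_def)
  show "(uniformity :: (L2 \<times> L2) filter) = (INF e\<in>{0<..}. principal {(x, y). dist x y < e})"
    by (rule uniformity_L2_def)
  show "open U = (\<forall>x\<in>U. eventually (\<lambda>(x', y). x' = x \<longrightarrow> y \<in> U) uniformity)"
    by (rule open_L2_def)
  show "inner u v = inner v u"
    by transfer (simp add: mult.commute)
  show "inner (u + v) w = inner u w + inner v w"
    by transfer (simp add: ae_eq_def square_integrable_mult distrib_right)
  show "inner (c *\<^sub>R u) v = c * inner u v"
    by transfer (simp add: mult.assoc)
  show "0 \<le> inner u u"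
    by transfer simp
  show "inner u u = 0 \<longleftrightarrow> u = 0"
  proof transfer
    fix f :: "real \<Rightarrow> real"
    assume "ae_eq f f"
    then have f: "square_integrable 0 1 f" by (simp add: ae_eq_def)
    show "(LINT x|unit_measure. f x * f x) = 0 \<longleftrightarrow> ae_eq f (\<lambda>x. 0)"
      using integral_nonneg_eq_0_iff_AE[OF square_integrable_mult[OF f f]] f
      by (simp add: ae_eq_def square_integrable_zero)
  qed
  show "norm u = sqrt (inner u u)"
    by (rule norm_L2_def)
qed

end

definition one_L2 :: L2
  where "one_L2 = abs_L2 (\<lambda>x. 1)"

text \<open>Meaningful whenever \<open>a\<close> is measurable and bounded on \<open>(0,1)\<close>, so that the product is in \<open>L\<^sup>2\<close>.\<close>

definition mult_L2 :: "(real \<Rightarrow> real) \<Rightarrow> L2 \<Rightarrow> L2"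
  where "mult_L2 a u = abs_L2 (\<lambda>x. a x * rep_L2 u x)"

text \<open>None of the notions below depends on the representatives chosen by \<open>rep_L2\<close>.\<close>

definition has_weak_dx :: "L2 \<Rightarrow> L2 \<Rightarrow> bool"
  where "has_weak_dx v g \<longleftrightarrow> weak_derivative 0 1 (rep_L2 v) (rep_L2 g)"

definition H1 :: "L2 set"
  where "H1 = {v. \<exists>g. has_weak_dx v g}"

definition dx :: "L2 \<Rightarrow> L2"
  where "dx v = (THE g. has_weak_dx v g)"

definition finite_dim_subspace :: "'a::real_vector set \<Rightarrow> bool"
  where "finite_dim_subspace S \<longleftrightarrow> subspace S \<and> (\<exists>B. finite B \<and> S = span B)"

definition orth_proj :: "'a::real_inner set \<Rightarrow> 'a \<Rightarrow> 'a"
  where "orth_proj S u = (THE w. w \<in> S \<and> (\<forall>v\<in>S. inner (u - w) v = 0))"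


section \<open>Functions of time\<close>

text \<open>
  \<open>w \<in> H\<^sup>1(0,T;X)\<close> with weak time derivative \<open>w'\<close>, for a finite-dimensional space \<open>X\<close>.
  As point values of \<open>w\<close> are used, \<open>w\<close> is the representative that is continuous on \<open>[0,T]\<close>.
\<close>

definition H1_time ::
    "real \<Rightarrow> 'a::real_normed_vector set \<Rightarrow> (real \<Rightarrow> 'a) \<Rightarrow> (real \<Rightarrow> 'a) \<Rightarrow> bool"
  where "H1_time T X w w' \<longleftrightarrow>
    (\<forall>t\<in>{0..T}. w t \<in> X) \<and> continuous_on {0..T} w \<and> square_integrable 0 T w \<and>
    (\<forall>t\<in>{0<..<T}. w' t \<in> X) \<and> square_integrable 0 T w' \<and>
    weak_derivative 0 T w w'"

text \<open>Classical derivatives of order \<open>k\<close> on \<open>[0,T]\<close>, one-sided at the end points.\<close>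

primrec dt :: "real \<Rightarrow> nat \<Rightarrow> (real \<Rightarrow> 'a::real_normed_vector) \<Rightarrow> real \<Rightarrow> 'a"
  where
    "dt T 0 w = w"
  | "dt T (Suc k) w = (\<lambda>t. vector_derivative (dt T k w) (at t within {0..T}))"

definition energy :: "real \<Rightarrow> nat \<Rightarrow> (real \<Rightarrow> L2) \<Rightarrow> (real \<Rightarrow> L2) \<Rightarrow> real \<Rightarrow> real"
  where "energy T k u p t = 1/2 * ((norm (dt T k u t))\<^sup>2 + (norm (dt T k p t))\<^sup>2)"

definition decay_rate :: "real \<Rightarrow> real \<Rightarrow> real"
  where "decay_rate a0 a1 =
    4/3 * (a0 ^ 3 / (8 * a0\<^sup>2 + 4 * a0\<^sup>2 * a1 + 2 * a0 * a1 + a1 ^ 4))"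

end

(*
  Weakly differentiable functions are primitives of their derivatives (du Bois-Reymond), so the
  semi-discrete solution solves a linear autonomous ODE, and all its time
  derivatives solve the same system; it suffices to treat k = 0. Given a solution (u, p), there is
  U in V with dx U = -p, (a U, 1) = -(u, 1) and dU/dt = u. A Poincare inequality gives
  norm U <= norm p + norm u / a0. For eps = 3/2 alpha the functional L = E + eps (u, U) satisfies
  E/2 <= L <= 3/2 E and L' <= - eps E <= - alpha L, so L decays at rate alpha and E loses only
  the factor 3.
*)
theory Submission
  imports Defs "HOL-Computational_Algebra.Polynomial"
begin

text \<open>The energy identity E' = - (a u, u) does not see p and degenerates wherever u vanishes;
  the cross term (u, U) is there to supply dissipation of p. U stands for a time integral of u: as
  dp/dt = - dx u, one expects dx U = - p, and Q = dx V provides such a U inside V. Testing the first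
  equation with U then produces - ||p||^2. The remaining constant in U is suggested by testing with
  1: (u, 1) + (a U, 1) is constant in time, and this constant is set to 0. So the quantity known
  about U is a mean with weight a, and the Poincare inequality is stated for that mean. The
  denominator of alpha collects two requirements on eps. One is eps (1/2 + 1/a0) <= 1/4, which keeps
  L between E/2 and 3/2 E. The other is eps (3/2 + a1/a0 + a1^2/2) <= a0, which lets the damping of
  u absorb the error terms in L'.\<close>

section \<open>Test functions\<close>

text \<open>Counting orders gives the closure proofs a number to induct on: the derivative of a
  product is a sum of products whose factors lose at most one order. Smoothness is recovered by
  quantifying over \<open>n\<close>.\<close>

definition differentiable_upto :: "nat \<Rightarrow> (real \<Rightarrow> real) \<Rightarrow> bool"
  where "differentiable_upto n f \<longleftrightarrow> (\<forall>k<n. (deriv ^^ k) f differentiable_on UNIV)"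

lemma differentiable_upto_Suc:
  "differentiable_upto (Suc n) f \<longleftrightarrow> f differentiable_on UNIV \<and> differentiable_upto n (deriv f)"
proof -
  have "(\<forall>k<Suc n. P k) \<longleftrightarrow> P 0 \<and> (\<forall>k<n. P (Suc k))" for P
    using less_Suc_eq_0_disj by auto
  then show ?thesis
    by (simp add: differentiable_upto_def funpow_Suc_right del: funpow.simps(2))
qed

lemma differentiable_upto_0: "differentiable_upto 0 f"
  by (simp add: differentiable_upto_def)

lemma differentiable_upto_mono: "differentiable_upto n f \<Longrightarrow> m \<le> n \<Longrightarrow> differentiable_upto m f"
  by (auto simp: differentiable_upto_def)

lemma smooth_iff:
  "(\<forall>k. (deriv ^^ k) f differentiable_on UNIV) \<longleftrightarrow> (\<forall>n. differentiable_upto n f)"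
  by (auto simp: differentiable_upto_def)

lemma differentiable_UNIV_DERIV:
  fixes f :: "real \<Rightarrow> real"
  shows "f differentiable_on UNIV \<Longrightarrow> (f has_real_derivative deriv f x) (at x)"
  by (simp add: differentiable_on_def DERIV_deriv_iff_real_differentiable)

lemma differentiable_upto_add:
  "differentiable_upto n f \<Longrightarrow> differentiable_upto n g \<Longrightarrow> differentiable_upto n (\<lambda>x. f x + g x)"
proof (induction n arbitrary: f g)
  case (Suc n)
  then have d: "f differentiable_on UNIV" "g differentiable_on UNIV"
    by (auto simp: differentiable_upto_Suc)
  have "deriv (\<lambda>x. f x + g x) = (\<lambda>x. deriv f x + deriv g x)"
    by (rule ext, rule DERIV_imp_deriv)
       (use d in \<open>auto intro!: derivative_eq_intros differentiable_UNIV_DERIV\<close>)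
  with Suc d show ?case
    by (simp add: differentiable_upto_Suc differentiable_on_add)
qed (simp add: differentiable_upto_0)

lemma differentiable_upto_mult:
  "differentiable_upto n f \<Longrightarrow> differentiable_upto n g \<Longrightarrow> differentiable_upto n (\<lambda>x. f x * g x)"
proof (induction n arbitrary: f g)
  case (Suc n)
  then have d: "f differentiable_on UNIV" "g differentiable_on UNIV"
    "differentiable_upto n (deriv f)" "differentiable_upto n (deriv g)"
    by (auto simp: differentiable_upto_Suc)
  have "differentiable_upto n f" "differentiable_upto n g"
    using Suc.prems by (auto intro: differentiable_upto_mono)
  moreover have "deriv (\<lambda>x. f x * g x) = (\<lambda>x. deriv f x * g x + f x * deriv g x)"
    by (rule ext, rule DERIV_imp_deriv)
       (use d in \<open>auto intro!: derivative_eq_intros differentiable_UNIV_DERIV\<close>)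
  ultimately show ?case
    using d Suc.IH by (simp add: differentiable_upto_Suc differentiable_upto_add)
qed (simp add: differentiable_upto_0)

lemma differentiable_upto_const: "differentiable_upto n (\<lambda>x. c)"
proof (induction n arbitrary: c)
  case (Suc n)
  have "deriv (\<lambda>x. c) = (\<lambda>x. 0 :: real)" by (rule ext) simp
  then show ?case using Suc by (simp add: differentiable_upto_Suc)
qed (simp add: differentiable_upto_0)

text \<open>
  Smoothness of the standard bump \<open>exp (- 1 / x)\<close> is obtained by carrying a polynomial factor in
  \<open>1 / x\<close>: the resulting family is closed under differentiation.
\<close>

definition exp_bump :: "real poly \<Rightarrow> real \<Rightarrow> real"
  where "exp_bump P x = (if x \<le> 0 then 0 else poly P (inverse x) * exp (- inverse x))"

lemma poly_mult_exp_minus_tendsto_0: "((\<lambda>y. poly P y * exp (- y)) \<longlongrightarrow> (0::real)) at_top"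
proof -
  have "((\<lambda>y. \<Sum>i\<le>degree P. coeff P i * (y ^ i / exp y)) \<longlongrightarrow> (\<Sum>i\<le>degree P. coeff P i * 0)) at_top"
    by (intro tendsto_intros tendsto_power_div_exp_0)
  moreover have "(\<lambda>y. \<Sum>i\<le>degree P. coeff P i * (y ^ i / exp y)) = (\<lambda>y. poly P y * exp (- y))"
    by (simp add: fun_eq_iff poly_altdef sum_distrib_right exp_minus divide_inverse mult.assoc)
  ultimately show ?thesis by simp
qed

text \<open>With y = 1/x one has dy/dx = - y^2, so P(y) exp(- y) has the derivative y^2 (P - P')(y)
  exp(- y); \<open>[:0, 0, 1:]\<close> is y^2. At 0 the exponential beats every polynomial in
  y.\<close>

lemma exp_bump_DERIV:
  "(exp_bump P has_real_derivative exp_bump ((P - pderiv P) * [:0, 0, 1:]) x) (at x)"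
proof -
  consider "x < 0" | "x > 0" | "x = 0" by linarith
  then show ?thesis
  proof cases
    case 1
    have "((\<lambda>x. 0) has_real_derivative 0) (at x)" by simp
    then have "(exp_bump P has_real_derivative 0) (at x)"
      by (rule has_field_derivative_transform_within_open[of _ _ _ "{..<0}"])
         (use 1 in \<open>auto simp: exp_bump_def\<close>)
    then show ?thesis using 1 by (simp add: exp_bump_def)
  next
    case 2
    have "((\<lambda>x. poly P (inverse x) * exp (- inverse x)) has_real_derivative
            poly ((P - pderiv P) * [:0, 0, 1:]) (inverse x) * exp (- inverse x)) (at x)"
      using 2 by (auto intro!: derivative_eq_intros DERIV_chain2[OF poly_DERIV]
          simp: algebra_simps power2_eq_square)
    then have "(exp_bump P has_real_derivative
            poly ((P - pderiv P) * [:0, 0, 1:]) (inverse x) * exp (- inverse x)) (at x)"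
      by (rule has_field_derivative_transform_within_open[of _ _ _ "{0<..}"])
         (use 2 in \<open>auto simp: exp_bump_def\<close>)
    then show ?thesis using 2 by (simp add: exp_bump_def)
  next
    case 3
    \<comment> \<open>To the right of 0 the difference quotient at 0 is y P(y) exp(- y), again a
      polynomial in y = 1/x times the exponential.\<close>
    have "((\<lambda>x. poly (P * [:0, 1:]) (inverse x) * exp (- inverse x)) \<longlongrightarrow> 0) (at_right (0::real))"
      by (rule filterlim_compose[OF poly_mult_exp_minus_tendsto_0 filterlim_inverse_at_top_right])
    then have r: "((\<lambda>x. exp_bump P x / x) \<longlongrightarrow> 0) (at_right 0)"
      by (rule Lim_transform_eventually)
         (auto simp: exp_bump_def eventually_at_right_less divide_inverse mult_ac
            intro!: eventually_mono[OF eventually_at_right_less[of "0::real"]])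
    have l: "((\<lambda>x. exp_bump P x / x) \<longlongrightarrow> 0) (at_left 0)"
      by (rule Lim_transform_eventually[OF tendsto_const])
         (auto simp: exp_bump_def eventually_at_filter)
    have "((\<lambda>x. exp_bump P x / x) \<longlongrightarrow> 0) (at 0)"
      using l r by (simp add: filterlim_at_split)
    then have "(exp_bump P has_real_derivative 0) (at 0)"
      by (simp add: has_field_derivative_iff exp_bump_def)
    then show ?thesis using 3 by (simp add: exp_bump_def)
  qed
qed

lemma differentiable_upto_exp_bump:
  "differentiable_upto n (\<lambda>x. exp_bump P (\<alpha> * x + \<beta>))"
proof (induction n arbitrary: P)
  case (Suc n)
  have *: "((\<lambda>x. exp_bump P (\<alpha> * x + \<beta>)) has_real_derivative
      exp_bump (smult \<alpha> ((P - pderiv P) * [:0, 0, 1:])) (\<alpha> * x + \<beta>)) (at x)" for x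
  proof -
    \<comment> \<open>The inner derivative \<alpha> is moved into the polynomial, so that the
      derivative is again covered by the induction hypothesis.\<close>
    have "exp_bump (smult \<alpha> Q) y = exp_bump Q y * \<alpha>" for Q y
      by (simp add: exp_bump_def)
    moreover have "((\<lambda>x. \<alpha> * x + \<beta>) has_real_derivative \<alpha>) (at x)"
      by (auto intro!: derivative_eq_intros)
    ultimately show ?thesis
      using DERIV_chain2[OF exp_bump_DERIV] by metis
  qed
  have "deriv (\<lambda>x. exp_bump P (\<alpha> * x + \<beta>)) =
      (\<lambda>x. exp_bump (smult \<alpha> ((P - pderiv P) * [:0, 0, 1:])) (\<alpha> * x + \<beta>))"
    by (rule ext, rule DERIV_imp_deriv, rule *)
  moreover have "(\<lambda>x. exp_bump P (\<alpha> * x + \<beta>)) differentiable_on UNIV"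
    using * unfolding differentiable_on_def
    by (auto simp: real_differentiable_def)
  ultimately show ?case
    using Suc by (simp add: differentiable_upto_Suc)
qed (simp add: differentiable_upto_0)

text \<open>A nonempty compact support is enlarged to the interval between its extreme points. As
  \<open>c \<le> d\<close> is not demanded, the zero function fits for all \<open>a\<close> and
  \<open>b\<close>.\<close>

lemma test_function_alt:
  "test_function a b \<phi> \<longleftrightarrow> (\<forall>n. differentiable_upto n \<phi>) \<and>
    (\<exists>c d. a < c \<and> d < b \<and> (\<forall>x. x \<notin> {c..d} \<longrightarrow> \<phi> x = 0))"
proof -
  have "(\<exists>K. compact K \<and> K \<subseteq> {a<..<b} \<and> (\<forall>x. x \<notin> K \<longrightarrow> \<phi> x = 0)) \<longleftrightarrow>
    (\<exists>c d. a < c \<and> d < b \<and> (\<forall>x. x \<notin> {c..d} \<longrightarrow> \<phi> x = 0))"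
  proof safe
    fix K assume K: "compact K" "K \<subseteq> {a<..<b}" "\<forall>x. x \<notin> K \<longrightarrow> \<phi> x = 0"
    show "\<exists>c d. a < c \<and> d < b \<and> (\<forall>x. x \<notin> {c..d} \<longrightarrow> \<phi> x = 0)"
    proof (cases "K = {}")
      case True
      then show ?thesis using K by (intro exI[of _ "a + 1"] exI[of _ "b - 1"]) auto
    next
      case False
      obtain c where "c \<in> K" "\<forall>x\<in>K. c \<le> x"
        using compact_attains_inf[OF K(1) False] by blast
      moreover obtain d where "d \<in> K" "\<forall>x\<in>K. x \<le> d"
        using compact_attains_sup[OF K(1) False] by blast
      ultimately show ?thesis using K by (intro exI[of _ c] exI[of _ d]) auto
    qed
  next
    fix c d assume "a < c" "d < b" "\<forall>x. x \<notin> {c..d} \<longrightarrow> \<phi> x = 0"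
    then show "\<exists>K. compact K \<and> K \<subseteq> {a<..<b} \<and> (\<forall>x. x \<notin> K \<longrightarrow> \<phi> x = 0)"
      by (intro exI[of _ "{c..d}"]) auto
  qed
  then show ?thesis by (simp add: test_function_def smooth_iff)
qed

lemma test_function_DERIV:
  "test_function a b \<phi> \<Longrightarrow> (\<phi> has_real_derivative deriv \<phi> x) (at x)"
  unfolding test_function_alt
  by (metis differentiable_UNIV_DERIV differentiable_upto_Suc)

lemma test_function_continuous_on: "test_function a b \<phi> \<Longrightarrow> continuous_on S \<phi>"
  using test_function_DERIV by (meson DERIV_continuous_on has_field_derivative_at_within)

lemma test_function_deriv:
  assumes "test_function a b \<phi>" shows "test_function a b (deriv \<phi>)"
proof -
  obtain c d where cd: "a < c" "d < b" "\<And>x. x \<notin> {c..d} \<Longrightarrow> \<phi> x = 0"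
    using assms unfolding test_function_alt by blast
  have "deriv \<phi> x = 0" if "x \<notin> {c..d}" for x
  proof -
    have "((\<lambda>x. 0) has_real_derivative 0) (at x)" by simp
    then have "(\<phi> has_real_derivative 0) (at x)"
      by (rule has_field_derivative_transform_within_open[of _ _ _ "- {c..d}"])
         (use that cd in auto)
    then show ?thesis by (rule DERIV_imp_deriv)
  qed
  then show ?thesis
    using assms cd(1,2) unfolding test_function_alt
    by (metis differentiable_upto_Suc)
qed

lemma test_function_bounded:
  assumes "test_function a b \<phi>" obtains B where "\<And>x. \<bar>\<phi> x\<bar> \<le> B"
proof -
  obtain c d where cd: "\<And>x. x \<notin> {c..d} \<Longrightarrow> \<phi> x = 0"
    using assms unfolding test_function_alt by blast
  have "bounded (\<phi> ` {c..d})"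
    by (intro compact_imp_bounded compact_continuous_image test_function_continuous_on[OF assms]) simp
  then obtain B where B: "\<And>x. x \<in> {c..d} \<Longrightarrow> \<bar>\<phi> x\<bar> \<le> B"
    by (force simp: bounded_iff)
  have "\<bar>\<phi> x\<bar> \<le> \<bar>B\<bar>" for x
    using B[of x] cd[of x] by (cases "x \<in> {c..d}") auto
  then show ?thesis by (rule that)
qed

lemma test_function_scale: "test_function a b \<phi> \<Longrightarrow> test_function a b (\<lambda>x. c * \<phi> x)"
  unfolding test_function_alt
  by (fastforce intro: differentiable_upto_mult[OF differentiable_upto_const])

lemma test_function_add:
  assumes "test_function a b \<phi>" "test_function a b \<psi>"
  shows "test_function a b (\<lambda>x. \<phi> x + \<psi> x)"
proof -
  obtain c d c' d' where "a < c" "d < b" "\<And>x. x \<notin> {c..d} \<Longrightarrow> \<phi> x = 0"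
    "a < c'" "d' < b" "\<And>x. x \<notin> {c'..d'} \<Longrightarrow> \<psi> x = 0"
    using assms unfolding test_function_alt by metis
  note cd = this
  have "\<phi> x + \<psi> x = 0" if "x \<notin> {min c c'..max d d'}" for x
  proof -
    have "\<phi> x = 0" by (rule cd(3)) (use that in auto)
    moreover have "\<psi> x = 0" by (rule cd(6)) (use that in auto)
    ultimately show ?thesis by simp
  qed
  with cd(1,2,4,5) have "a < min c c' \<and> max d d' < b \<and>
      (\<forall>x. x \<notin> {min c c'..max d d'} \<longrightarrow> \<phi> x + \<psi> x = 0)"
    by auto
  with assms show ?thesis unfolding test_function_alt
    by (blast intro: differentiable_upto_add)
qed

text \<open>One factor switches on at \<open>c\<close>, the other switches off at \<open>d\<close>,
  and \<open>r\<close> is the steepness. The arguments have the affine form of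
  \<open>differentiable_upto_exp_bump\<close>.\<close>

lemma test_function_exp_bump:
  assumes "a < c" "d < b" "0 < r"
  shows "test_function a b (\<lambda>x. exp_bump 1 (r * x + - (r * c)) * exp_bump 1 (- r * x + r * d))"
  unfolding test_function_alt
proof (intro conjI allI exI)
  show "differentiable_upto n
      (\<lambda>x. exp_bump 1 (r * x + - (r * c)) * exp_bump 1 (- r * x + r * d))" for n
    by (intro differentiable_upto_mult differentiable_upto_exp_bump)
  show "x \<notin> {c..d} \<longrightarrow> exp_bump 1 (r * x + - (r * c)) * exp_bump 1 (- r * x + r * d) = 0" for x
    using assms by (auto simp: exp_bump_def)
qed (use assms in auto)

text \<open>Integration from \<open>a\<close> gives 0 to the left of the support, and the vanishing
  mean gives 0 to its right, so the primitive is compactly supported again.\<close>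

lemma test_function_primitive:
  assumes "test_function a b \<psi>" "(\<psi> has_integral 0) {a..b}" "a < b"
  obtains \<phi> where "test_function a b \<phi>" "deriv \<phi> = \<psi>"
proof -
  obtain c d where cd: "a < c" "d < b" "\<And>x. x \<notin> {c..d} \<Longrightarrow> \<psi> x = 0"
    using assms unfolding test_function_alt by blast
  have cont: "continuous_on S \<psi>" for S by (rule test_function_continuous_on[OF assms(1)])
  then have int: "\<psi> integrable_on {u..v}" for u v
    by (simp add: integrable_continuous_real)
  have zero: "integral {u..v} \<psi> = 0" if "v < c \<or> d < u" for u v
  proof -
    have "integral {u..v} \<psi> = integral {u..v} (\<lambda>x. 0)"
      by (rule Henstock_Kurzweil_Integration.integral_cong) (use that cd in auto)
    then show ?thesis by simp
  qed
  define \<phi> where "\<phi> x = integral {a..x} \<psi>" for x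
  have outside: "\<phi> x = 0" if x: "x \<notin> {c..d}" for x
  proof -
    \<comment> \<open>As \<open>c \<le> d\<close> is not known, a point beyond \<open>d\<close> may
      still lie left of \<open>a\<close>; there the integral runs over an empty interval.\<close>
    consider "x < c" | "x > d" "x < a" | "x > d" "a \<le> x" "x \<le> b" | "x > b" 
      using x by (metis atLeastAtMost_iff linorder_not_le)
    then show ?thesis
    proof cases
      case 1 then show ?thesis by (simp add: \<phi>_def zero)
    next
      case 2 then show ?thesis by (simp add: \<phi>_def)
    next
      case 3
      then have "integral {a..x} \<psi> + integral {x..b} \<psi> = integral {a..b} \<psi>"
        using int by (intro Henstock_Kurzweil_Integration.integral_combine) auto
      then show ?thesis using 3 zero[of b x] assms(2) by (simp add: \<phi>_def integral_unique)
    next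
      case 4
      then have "integral {a..b} \<psi> + integral {b..x} \<psi> = integral {a..x} \<psi>"
        using int assms(3) by (intro Henstock_Kurzweil_Integration.integral_combine) auto
      then show ?thesis using cd zero[of x b] assms(2) by (simp add: \<phi>_def integral_unique)
    qed
  qed
  have D: "(\<phi> has_real_derivative \<psi> x) (at x)" for x
  proof (cases "x < c")
    case True
    have "((\<lambda>x. 0) has_real_derivative 0) (at x)" by simp
    then have "(\<phi> has_real_derivative 0) (at x)"
      by (rule has_field_derivative_transform_within_open[of _ _ _ "{..<c}"])
         (use True outside in auto)
    then show ?thesis using True cd by simp
  next
    case False
    \<comment> \<open>Here \<open>a < c \<le> x\<close>, so \<open>x\<close> is interior to the
      auxiliary interval \<open>{a..x+1}\<close> and the derivative within it is the full
      derivative.\<close>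
    have "(\<phi> has_real_derivative \<psi> x) (at x within {a..x+1})"
      unfolding \<phi>_def
      by (rule integral_has_real_derivative) (use False cd in \<open>auto intro: cont\<close>)
    then show ?thesis
      by (subst (asm) at_within_interior) (use False cd in auto)
  qed
  have der: "deriv \<phi> = \<psi>" by (rule ext, rule DERIV_imp_deriv, rule D)
  have "\<phi> differentiable_on UNIV"
    using D by (auto simp: differentiable_on_def real_differentiable_def)
  then have "differentiable_upto n \<phi>" for n
    using der assms(1)
    by (cases n) (auto simp: test_function_alt differentiable_upto_Suc differentiable_upto_0)
  then have "test_function a b \<phi>" unfolding test_function_alt using cd outside by blast
  then show ?thesis using der by (rule that)
qed

section \<open>The lemma of du Bois-Reymond\<close>

lemma finite_measure_Ioo: "finite_measure (lebesgue_on {a<..<b::real})"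
  by (intro finite_measure_lebesgue_on) (metis box_real(1) lmeasurable_box)

lemma has_integral_Icc_lebesgue_on:
  fixes F :: "real \<Rightarrow> real"
  assumes "integrable (lebesgue_on {a<..<b}) F"
  shows "(F has_integral (LINT x|lebesgue_on {a<..<b}. F x)) {a..b}"
  unfolding has_integral_Icc_iff_Ioo by (rule has_integral_integral_lebesgue_on[OF assms]) simp

lemma continuous_imp_measurable_lebesgue_on_Ioo:
  fixes f :: "real \<Rightarrow> real"
  shows "continuous_on UNIV f \<Longrightarrow> f \<in> borel_measurable (lebesgue_on {a<..<b})"
  by (intro continuous_imp_measurable_on_sets_lebesgue) (auto intro: continuous_on_subset)

lemma integrable_bounded_mult:
  fixes f \<phi> :: "'a \<Rightarrow> real"
  assumes f: "integrable M f" and "\<phi> \<in> borel_measurable M" "\<And>x. x \<in> space M \<Longrightarrow> \<bar>\<phi> x\<bar> \<le> B"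
  shows "integrable M (\<lambda>x. \<phi> x * f x)"
proof (rule Bochner_Integration.integrable_bound[of M "\<lambda>x. B * f x"])
  show "AE x in M. norm (\<phi> x * f x) \<le> norm (B * f x)"
  proof (rule AE_I2)
    fix x assume "x \<in> space M"
    from assms(3)[OF this] have "\<bar>\<phi> x\<bar> \<le> \<bar>B\<bar>" by linarith
    then show "norm (\<phi> x * f x) \<le> norm (B * f x)"
      by (simp add: abs_mult mult_right_mono)
  qed
qed (use assms in auto)

lemma indicator_measurable_lebesgue_on:
  "S \<in> sets lebesgue \<Longrightarrow> (indicator S :: _ \<Rightarrow> real) \<in> borel_measurable (lebesgue_on T)"
  by (intro measurable_restrict_space1 borel_measurable_indicator)

lemma test_function_mult_integrable:
  assumes "integrable (lebesgue_on {a<..<b}) f" "test_function a b \<phi>"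
  shows "integrable (lebesgue_on {a<..<b}) (\<lambda>x. \<phi> x * f x)"
proof -
  obtain B where "\<And>x. \<bar>\<phi> x\<bar> \<le> B" using test_function_bounded[OF assms(2)] by blast
  then show ?thesis
    using assms test_function_continuous_on[OF assms(2)]
    by (intro integrable_bounded_mult continuous_imp_measurable_lebesgue_on_Ioo) auto
qed

text \<open>The positive and negative parts of \<open>f\<close> are densities of two finite measures
  that agree on all half-lines and hence coincide; a finite measure determines its density almost
  everywhere.\<close>

lemma AE_zero_if_integral_Ioi_zero:
  fixes f :: "real \<Rightarrow> real"
  assumes f: "integrable lborel f" and z: "\<And>x. (LINT y|lborel. indicator {x<..} y * f y) = 0"
  shows "AE x in lborel. f x = 0"
proof -
  have [measurable]: "f \<in> borel_measurable borel" using f by auto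
  have int: "integrable lborel (\<lambda>y. max 0 (f y))" "integrable lborel (\<lambda>y. max 0 (- f y))"
    using f by auto
  have int': "integrable lborel (\<lambda>y. indicator {x<..} y * max 0 (f y))"
    "integrable lborel (\<lambda>y. indicator {x<..} y * max 0 (- f y))" for x
    by (rule integrable_bounded_mult[where B = 1], use int in \<open>auto simp: indicator_def\<close>)+
  have em: "emeasure (density lborel (\<lambda>y. ennreal (g y))) {x<..} =
      ennreal (LINT y|lborel. indicator {x<..} y * g y)"
    if "integrable lborel (\<lambda>y. indicator {x<..} y * g y)" "\<And>y. 0 \<le> g y"
      "g \<in> borel_measurable borel" for x and g :: "real \<Rightarrow> real"
  proof -
    have "emeasure (density lborel (\<lambda>y. ennreal (g y))) {x<..} =
        (\<integral>\<^sup>+y. ennreal (indicator {x<..} y * g y) \<partial>lborel)"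
      using that by (subst emeasure_density)
        (auto intro!: nn_integral_cong simp: indicator_def)
    also have "\<dots> = ennreal (LINT y|lborel. indicator {x<..} y * g y)"
      using that by (intro nn_integral_eq_integral) auto
    finally show ?thesis .
  qed
  have eq: "(LINT y|lborel. indicator {x<..} y * max 0 (f y)) =
      (LINT y|lborel. indicator {x<..} y * max 0 (- f y))" for x
  proof -
    have "(LINT y|lborel. indicator {x<..} y * max 0 (f y) - indicator {x<..} y * max 0 (- f y)) =
        (LINT y|lborel. indicator {x<..} y * f y)"
      by (intro Bochner_Integration.integral_cong) (auto simp: indicator_def)
    then show ?thesis using int'[of x] z[of x] by simp
  qed
  have "density lborel (\<lambda>y. ennreal (max 0 (f y))) = density lborel (\<lambda>y. ennreal (max 0 (- f y)))"
    by (rule measure_eqI_lessThan) (use int' eq in \<open>auto simp: em\<close>)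
  then have "AE x in lborel. ennreal (max 0 (f x)) = ennreal (max 0 (- f x))"
    using nn_integral_eq_integral[OF int(1)] by (subst finite_density_unique[symmetric]) auto
  then show ?thesis
    by eventually_elim (simp add: max_def split: if_splits)
qed

lemma exp_bump_1_tendsto_1: "(exp_bump 1 \<longlongrightarrow> 1) at_top"
proof -
  have "((\<lambda>x::real. exp (- inverse x)) \<longlongrightarrow> exp (- 0)) at_top"
    by (intro tendsto_intros tendsto_inverse_0_at_top filterlim_ident)
  then have "((\<lambda>x::real. exp (- inverse x)) \<longlongrightarrow> 1) at_top" by simp
  then show ?thesis
    by (rule Lim_transform_eventually)
       (auto simp: exp_bump_def intro!: eventually_mono[OF eventually_gt_at_top[of 0]])
qed

lemma exp_bump_1_bounds: "0 \<le> exp_bump 1 x" "exp_bump 1 x \<le> 1"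
  by (auto simp: exp_bump_def)

text \<open>Ever steeper bumps tend boundedly to the indicators of \<open>{c<..<b}\<close>, so by
  dominated convergence \<open>h\<close> has integral 0 over all these intervals; the half-line
  criterion then applies.\<close>

lemma AE_zero_if_test_function_integrals_zero:
  assumes h: "integrable (lebesgue_on {a<..<b}) h"
    and z: "\<And>\<phi>. test_function a b \<phi> \<Longrightarrow> (LINT x|lebesgue_on {a<..<b}. \<phi> x * h x) = 0"
  shows "AE x in lebesgue_on {a<..<b}. h x = 0"
proof -
  define M where "M = lebesgue_on {a<..<b}"
  have Ioi: "(LINT x|M. indicator {c<..} x * h x) = 0" if "a \<le> c" for c
  proof -
    \<comment> \<open>test functions supported in \<open>{c + 1/(n+1)..b - 1/(n+1)}\<close> that converge to the indicator of \<open>{c<..<b}\<close>\<close>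
    define \<phi> where "\<phi> n x = exp_bump 1 (real (Suc n) * x + - (real (Suc n) * (c + 1 / real (Suc n)))) *
      exp_bump 1 (- real (Suc n) * x + real (Suc n) * (b - 1 / real (Suc n)))" for n x
    have tf: "test_function a b (\<phi> n)" for n
    proof -
      have "0 < 1 / real (Suc n)" by simp
      then have "a < c + 1 / real (Suc n)" "b - 1 / real (Suc n) < b" using that by linarith+
      then show ?thesis unfolding \<phi>_def by (intro test_function_exp_bump) auto
    qed
    have \<phi>_eq: "\<phi> n x = exp_bump 1 ((x - c) * real (Suc n) - 1) * exp_bump 1 ((b - x) * real (Suc n) - 1)" for n x
    proof -
      have "real (Suc n) * x + - (real (Suc n) * (c + 1 / real (Suc n))) = (x - c) * real (Suc n) - 1"
        "- real (Suc n) * x + real (Suc n) * (b - 1 / real (Suc n)) = (b - x) * real (Suc n) - 1"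
        by (simp_all add: field_simps)
      then show ?thesis by (simp only: \<phi>_def)
    qed
    have bound: "\<bar>\<phi> n x\<bar> \<le> 1" for n x
      using exp_bump_1_bounds by (simp add: \<phi>_eq abs_mult mult_le_one)
    have one: "(\<lambda>n. exp_bump 1 (r * real (Suc n) - 1)) \<longlonglongrightarrow> 1" if "0 < r" for r
    proof -
      have "filterlim (\<lambda>n. -1 + r * real (Suc n)) at_top sequentially"
        by (intro filterlim_tendsto_add_at_top[OF tendsto_const]
            filterlim_tendsto_pos_mult_at_top[OF tendsto_const that]
            filterlim_compose[OF filterlim_real_sequentially filterlim_Suc])
      then show ?thesis
        using filterlim_compose[OF exp_bump_1_tendsto_1] by simp
    qed
    have lim: "(\<lambda>n. \<phi> n x) \<longlonglongrightarrow> indicator {c<..} x" if "x < b" for x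
    proof (cases "c < x")
      case True
      have "(\<lambda>n. \<phi> n x) \<longlonglongrightarrow> 1 * 1"
        unfolding \<phi>_eq by (intro tendsto_mult one) (use True that in auto)
      then show ?thesis using True by simp
    next
      case False
      then have "(x - c) * real (Suc n) - 1 \<le> 0" for n
        by (smt (verit) mult_nonpos_nonneg of_nat_0_le_iff)
      then have "\<phi> n x = 0" for n
        by (simp add: \<phi>_eq exp_bump_def)
      then show ?thesis using False by simp
    qed
    have "(\<lambda>n. LINT x|M. \<phi> n x * h x) \<longlonglongrightarrow> (LINT x|M. indicator {c<..} x * h x)"
    proof (rule integral_dominated_convergence[where w = "\<lambda>x. \<bar>h x\<bar>"])
      have hm: "h \<in> borel_measurable M" using h by (auto simp: M_def)
      then show "(\<lambda>x. indicator {c<..} x * h x) \<in> borel_measurable M"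
        unfolding M_def by (intro borel_measurable_times indicator_measurable_lebesgue_on) auto
      show "(\<lambda>x. \<phi> n x * h x) \<in> borel_measurable M" for n
        using test_function_mult_integrable[OF h tf[of n]] by (auto simp: M_def)
      show "AE x in M. (\<lambda>n. \<phi> n x * h x) \<longlonglongrightarrow> indicator {c<..} x * h x"
        by (rule AE_I2) (auto intro!: tendsto_mult_right lim simp: M_def space_restrict_space)
      show "AE x in M. norm (\<phi> n x * h x) \<le> \<bar>h x\<bar>" for n
        using bound by (simp add: abs_mult mult_left_le_one_le)
    qed (use h in \<open>auto simp: M_def\<close>)
    moreover have "(LINT x|M. \<phi> n x * h x) = 0" for n
      using z[OF tf] by (simp add: M_def)
    ultimately show ?thesis by (simp add: LIMSEQ_const_iff)
  qed
  \<comment> \<open>The half-line criterion is about the whole line and \<open>lborel\<close>: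
    \<open>h\<close> is extended by zero and then replaced by a Borel representative
    \<open>H'\<close>.\<close>
  define H where "H x = indicator {a<..<b} x * h x" for x
  have H: "integrable lebesgue H"
    using h by (subst (asm) integrable_restrict_space) (auto simp: H_def[abs_def])
  then obtain H' where H': "H' \<in> borel_measurable lborel" "AE x in lborel. H x = H' x"
    using completion_ex_borel_measurable_real[OF borel_measurable_integrable] by blast
  have ae: "AE x in lebesgue. H x = H' x" using H'(2) by (rule AE_completion)
  have H'm: "H' \<in> borel_measurable lebesgue" using H'(1) by (simp add: measurable_completion)
  have "integrable lebesgue H'" by (rule integrable_cong_AE_imp[OF H H'm ae])
  then have iH': "integrable lborel H'" using H'(1) integrable_completion by blast
  have "(LINT y|lborel. indicator {x<..} y * H' y) = 0" for x
  proof -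
    have "(LINT y|lborel. indicator {x<..} y * H' y) = (LINT y|lebesgue. indicator {x<..} y * H' y)"
      using H'(1) by (intro integral_completion[symmetric]) auto
    also have "\<dots> = (LINT y|lebesgue. indicator {x<..} y * H y)"
      using ae H'm H
      by (intro integral_cong_AE borel_measurable_times borel_measurable_indicator) auto
    \<comment> \<open>\<open>Ioi\<close> wants a lower limit of at least \<open>a\<close>; inside
      \<open>{a<..<b}\<close> the limits \<open>x\<close> and \<open>max a x\<close> select the same
      points.\<close>
    also have "\<dots> = (LINT y|lebesgue. indicator {a<..<b} y *\<^sub>R (indicator {max a x<..} y * h y))"
      by (intro Bochner_Integration.integral_cong) (auto simp: indicator_def H_def)
    also have "\<dots> = (LINT y|M. indicator {max a x<..} y * h y)"
      unfolding M_def by (intro integral_restrict_space[symmetric]) simp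
    also have "\<dots> = 0" by (rule Ioi) simp
    finally show ?thesis .
  qed
  with iH' have "AE x in lborel. H' x = 0" by (rule AE_zero_if_integral_Ioi_zero)
  then have "AE x in lebesgue. H' x = 0" by (rule AE_completion)
  with ae have "AE x in lebesgue. x \<in> {a<..<b} \<longrightarrow> h x = 0"
    by eventually_elim (auto simp: H_def)
  then show ?thesis by (simp add: AE_restrict_space_iff)
qed

lemma not_AE_False_Ioo: "a < b \<Longrightarrow> \<not> (AE x in lebesgue_on {a<..<b::real}. False)"
proof
  assume "a < b" "AE x in lebesgue_on {a<..<b}. False"
  then have "AE x in lebesgue. x \<notin> {a<..<b}" by (simp add: AE_restrict_space_iff)
  then have "emeasure lebesgue {a<..<b} = 0"
    by (subst (asm) AE_iff_measurable[of "{a<..<b}"]) auto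
  with \<open>a < b\<close> show False by simp
qed

text \<open>Every test function is a multiple of one fixed \<open>\<psi>\<^sub>0\<close> of nonzero
  mean plus the derivative of a test function. So \<open>h - c\<close> is annihilated by all of them
  once \<open>c\<close> is right for \<open>\<psi>\<^sub>0\<close>.\<close>

lemma AE_const_if_test_function_deriv_integrals_zero:
  assumes h: "integrable (lebesgue_on {a<..<b}) h" and "a < b"
    and z: "\<And>\<phi>. test_function a b \<phi> \<Longrightarrow> (LINT x|lebesgue_on {a<..<b}. deriv \<phi> x * h x) = 0"
  shows "\<exists>c. AE x in lebesgue_on {a<..<b}. h x = c"
proof -
  define M where "M = lebesgue_on {a<..<b}"
  interpret finite_measure M unfolding M_def by (rule finite_measure_Ioo)
  have int: "integrable M (\<lambda>x. \<psi> x * h x)" "integrable M \<psi>" if "test_function a b \<psi>" for \<psi>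
    using test_function_mult_integrable[OF _ that, of h]
      test_function_mult_integrable[OF _ that, of "\<lambda>x. 1"] h by (auto simp: M_def[symmetric])
  \<comment> \<open>If every test function had mean zero, the constant 1 would vanish almost
    everywhere.\<close>
  obtain \<psi>\<^sub>0 where \<psi>\<^sub>0: "test_function a b \<psi>\<^sub>0" "(LINT x|M. \<psi>\<^sub>0 x) \<noteq> 0"
  proof (rule ccontr)
    assume "\<not> thesis"
    then have "\<And>\<phi>. test_function a b \<phi> \<Longrightarrow> (LINT x|M. \<phi> x * 1) = 0" using that by auto
    then have "AE x in M. (1::real) = 0"
      unfolding M_def
      by (intro AE_zero_if_test_function_integrals_zero) (auto simp: M_def[symmetric])
    then have "AE x in M. False" by simp
    with not_AE_False_Ioo[OF \<open>a < b\<close>] show False unfolding M_def by blast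
  qed
  define c where "c = (LINT x|M. \<psi>\<^sub>0 x * h x) / (LINT x|M. \<psi>\<^sub>0 x)"
  have "AE x in M. h x - c = 0"
    unfolding M_def
  proof (rule AE_zero_if_test_function_integrals_zero)
    show "integrable (lebesgue_on {a<..<b}) (\<lambda>x. h x - c)"
      using h by (auto simp: M_def[symmetric])
    fix \<psi> assume \<psi>: "test_function a b \<psi>"
    \<comment> \<open>subtracting \<open>r * \<psi>\<^sub>0\<close> makes the mean vanish, so the difference is the derivative of a test function\<close>
    define r where "r = (LINT x|M. \<psi> x) / (LINT x|M. \<psi>\<^sub>0 x)"
    have t: "test_function a b (\<lambda>x. \<psi> x + - r * \<psi>\<^sub>0 x)"
      by (intro test_function_add test_function_scale \<psi> \<psi>\<^sub>0)
    have "(LINT x|M. \<psi> x + - r * \<psi>\<^sub>0 x) = 0"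
      using int[OF \<psi>] int[OF \<psi>\<^sub>0(1)] \<psi>\<^sub>0(2) by (simp add: r_def)
    then have "((\<lambda>x. \<psi> x + - r * \<psi>\<^sub>0 x) has_integral 0) {a..b}"
      using has_integral_Icc_lebesgue_on[of a b "\<lambda>x. \<psi> x + - r * \<psi>\<^sub>0 x"] int(2)[OF t] by (simp add: M_def)
    then obtain \<phi> where "test_function a b \<phi>" "deriv \<phi> = (\<lambda>x. \<psi> x + - r * \<psi>\<^sub>0 x)"
      using test_function_primitive[OF t _ \<open>a < b\<close>] by blast
    then have "0 = (LINT x|M. (\<psi> x + - r * \<psi>\<^sub>0 x) * h x)"
      using z[of \<phi>] by (simp add: M_def)
    also have "\<dots> = (LINT x|M. \<psi> x * h x - r * (\<psi>\<^sub>0 x * h x))"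
      by (simp add: algebra_simps)
    also have "\<dots> = (LINT x|M. \<psi> x * h x) - r * (LINT x|M. \<psi>\<^sub>0 x * h x)"
      using int[OF \<psi>] int[OF \<psi>\<^sub>0(1)] by simp
    also have "\<dots> = (LINT x|M. \<psi> x * h x) - c * (LINT x|M. \<psi> x)"
      by (simp add: r_def c_def)
    also have "\<dots> = (LINT x|M. \<psi> x * (h x - c))"
      using int[OF \<psi>] by (simp add: right_diff_distrib mult.commute)
    finally show "(LINT x|lebesgue_on {a<..<b}. \<psi> x * (h x - c)) = 0" by (simp add: M_def)
  qed
  then have "AE x in M. h x = c" by simp
  then show ?thesis unfolding M_def by blast
qed

section \<open>Primitives of integrable functions and integration by parts\<close>

lemma measurable_triangle_times:
  fixes g \<psi> :: "real \<Rightarrow> real"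
  assumes "g \<in> borel_measurable (lebesgue_on {a<..<b})" "\<psi> \<in> borel_measurable (lebesgue_on {a<..<b})"
  shows "(\<lambda>(x, y). \<psi> x * (indicator {..<x} y * g y))
    \<in> borel_measurable (lebesgue_on {a<..<b} \<Otimes>\<^sub>M lebesgue_on {a<..<b})"
proof -
  note [measurable] = assms
  have [measurable]: "(\<lambda>x. x) \<in> borel_measurable (lebesgue_on {a<..<b})"
    by (rule continuous_imp_measurable_lebesgue_on_Ioo) simp
  \<comment> \<open>In \<open>indicator {..<x} y\<close> the set itself varies with
    \<open>x\<close>; as a comparison of the two coordinates the factor is visibly jointly
    measurable.\<close>
  have "(\<lambda>p. \<psi> (fst p) * ((if snd p < fst p then 1 else 0) * g (snd p)))
      \<in> borel_measurable (lebesgue_on {a<..<b} \<Otimes>\<^sub>M lebesgue_on {a<..<b})"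
    by measurable
  then show ?thesis
    by (rule measurable_cong[THEN iffD1, rotated]) (auto simp: indicator_def)
qed

lemma borel_measurable_primitive:
  fixes g :: "real \<Rightarrow> real"
  assumes g: "integrable (lebesgue_on {a<..<b}) g"
  shows "(\<lambda>x. LINT y|lebesgue_on {a<..<b}. indicator {..<x} y * g y) \<in> borel_measurable (lebesgue_on {a<..<b})"
proof -
  interpret finite_measure "lebesgue_on {a<..<b}" by (rule finite_measure_Ioo)
  show ?thesis
    using measurable_triangle_times[of g a b "\<lambda>x. 1"] g
    by (intro borel_measurable_lebesgue_integral) auto
qed

lemma indicator_mult_integrable:
  fixes g :: "real \<Rightarrow> real"
  assumes g: "integrable (lebesgue_on {a<..<b}) g"
  shows "integrable (lebesgue_on {a<..<b}) (\<lambda>y. indicator {..<x} y * g y)"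
  by (rule integrable_bounded_mult[OF g indicator_measurable_lebesgue_on, where B = 1])
     (auto simp: indicator_def)

lemma primitive_abs_le:
  fixes g :: "real \<Rightarrow> real"
  assumes g: "integrable (lebesgue_on {a<..<b}) g"
  shows "\<bar>LINT y|lebesgue_on {a<..<b}. indicator {..<x} y * g y\<bar> \<le> (LINT y|lebesgue_on {a<..<b}. \<bar>g y\<bar>)"
proof -
  have "\<bar>LINT y|lebesgue_on {a<..<b}. indicator {..<x} y * g y\<bar> \<le>
      (LINT y|lebesgue_on {a<..<b}. \<bar>indicator {..<x} y * g y\<bar>)"
    by (rule integral_abs_bound)
  also have "\<dots> \<le> (LINT y|lebesgue_on {a<..<b}. \<bar>g y\<bar>)"
    using g indicator_mult_integrable[OF g, of x]
    by (intro integral_mono integrable_abs) (auto simp: indicator_def)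
  finally show ?thesis .
qed

lemma integrable_primitive:
  fixes g :: "real \<Rightarrow> real"
  assumes g: "integrable (lebesgue_on {a<..<b}) g"
  shows "integrable (lebesgue_on {a<..<b}) (\<lambda>x. LINT y|lebesgue_on {a<..<b}. indicator {..<x} y * g y)"
proof -
  interpret finite_measure "lebesgue_on {a<..<b}" by (rule finite_measure_Ioo)
  show ?thesis
    using primitive_abs_le[OF g] borel_measurable_primitive[OF g]
    by (intro integrable_const_bound) auto
qed

text \<open>The inner integral after the exchange in Fubini: for fixed \<open>y\<close> the
  indicator restricts to x > y, and the fundamental theorem leaves \<phi>(b) - \<phi>(y) with
  \<phi>(b) = 0.\<close>

lemma test_function_integral_deriv_Ioi:
  assumes \<phi>: "test_function a b \<phi>" and y: "y \<in> {a<..<b}"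
  shows "(LINT x|lebesgue_on {a<..<b}. deriv \<phi> x * indicator {..<x} y) = - \<phi> y"
proof -
  have "(deriv \<phi> has_integral (\<phi> b - \<phi> y)) {y..b}"
    using y test_function_DERIV[OF \<phi>]
    by (intro fundamental_theorem_of_calculus)
       (auto intro: has_vector_derivative_at_within simp: has_real_derivative_iff_has_vector_derivative)
  moreover have "\<phi> b = 0"
    using \<phi> unfolding test_function_alt by (metis atLeastAtMost_iff linorder_not_le)
  ultimately have "(deriv \<phi> has_integral - \<phi> y) {y<..<b}"
    by (simp add: has_integral_Icc_iff_Ioo)
  then have "((\<lambda>x. deriv \<phi> x * indicator {..<x} y) has_integral - \<phi> y) {y<..<b}"
    by (rule has_integral_eq[rotated]) auto
  \<comment> \<open>This serves the extension by zero to the closed interval: at the end point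
    \<open>b\<close> the indicator equals 1, so the derivative has to vanish there.\<close>
  moreover have "deriv \<phi> x = 0" if "b \<le> x" for x
    using test_function_deriv[OF \<phi>] that unfolding test_function_alt
    by (metis atLeastAtMost_iff linorder_not_le order.strict_trans1)
  ultimately have 1: "((\<lambda>x. deriv \<phi> x * indicator {..<x} y) has_integral - \<phi> y) {a..b}"
    by (intro has_integral_on_superset[where T = "{a..b}" and S = "{y<..<b}"]) (use y in auto)
  have eq: "indicator {..<x} y = (indicator {y<..} x :: real)" for x
    by (simp add: indicator_def)
  have m: "indicat_real {y<..} \<in> borel_measurable (lebesgue_on {a<..<b})"
    by (rule indicator_measurable_lebesgue_on) simp
  interpret finite_measure "lebesgue_on {a<..<b}" by (rule finite_measure_Ioo)
  have "integrable (lebesgue_on {a<..<b}) (\<lambda>x. deriv \<phi> x * indicator {..<x} y)"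
    unfolding eq
    by (rule test_function_mult_integrable[OF _ test_function_deriv[OF \<phi>]])
       (rule integrable_const_bound[where B = 1], use m in auto)
  from has_integral_Icc_lebesgue_on[OF this] 1 show ?thesis
    by (rule has_integral_unique)
qed

text \<open>Fubini on the triangle y < x reduces the claim to the integral of
  \<open>deriv \<phi>\<close> from y to b. This works for every integrable \<open>g\<close>.\<close>

lemma test_function_integral_by_parts:
  assumes g: "integrable (lebesgue_on {a<..<b}) g" and \<phi>: "test_function a b \<phi>"
  shows "(LINT x|lebesgue_on {a<..<b}. deriv \<phi> x * (LINT y|lebesgue_on {a<..<b}. indicator {..<x} y * g y)) =
    - (LINT x|lebesgue_on {a<..<b}. \<phi> x * g x)"
proof -
  define M where "M = lebesgue_on {a<..<b}"
  interpret finite_measure M unfolding M_def by (rule finite_measure_Ioo)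
  interpret pair_sigma_finite M M ..
  have gM: "integrable M g" using g by (simp add: M_def)
  have \<phi>': "test_function a b (deriv \<phi>)" by (rule test_function_deriv[OF \<phi>])
  obtain B where B: "\<And>x. \<bar>deriv \<phi> x\<bar> \<le> B" using test_function_bounded[OF \<phi>'] by blast
  have m\<phi>: "deriv \<phi> \<in> borel_measurable M"
    unfolding M_def
    by (intro continuous_imp_measurable_lebesgue_on_Ioo test_function_continuous_on[OF \<phi>'])
  define F where "F = (\<lambda>(x, y). deriv \<phi> x * (indicator {..<x} y * g y))"
  have mF: "F \<in> borel_measurable (M \<Otimes>\<^sub>M M)"
    unfolding F_def M_def
    by (rule measurable_triangle_times) (use g m\<phi> in \<open>auto simp: M_def\<close>)
  have intF: "integrable (M \<Otimes>\<^sub>M M) F"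
  proof (rule Fubini_integrable[OF mF])
    have "(\<lambda>x. LINT y|M. norm (F (x, y))) \<in> borel_measurable M"
      using mF by measurable
    moreover have "norm (LINT y|M. norm (F (x, y))) \<le> B * (LINT y|M. \<bar>g y\<bar>)" for x
    proof -
      have "(LINT y|M. norm (F (x, y))) \<le> (LINT y|M. B * \<bar>g y\<bar>)"
      proof (rule integral_mono)
        show "integrable M (\<lambda>y. norm (F (x, y)))"
          using integrable_norm[OF indicator_mult_integrable[OF g, of x]]
          by (simp add: F_def M_def abs_mult)
        show "norm (F (x, y)) \<le> B * \<bar>g y\<bar>" for y
          using mult_mono[OF B[of x] order_refl[of "\<bar>g y\<bar>"]] B[of x]
          by (auto simp: F_def abs_mult indicator_def)
      qed (use gM in auto)
      then show ?thesis by simp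
    qed
    ultimately show "integrable M (\<lambda>x. LINT y|M. norm (F (x, y)))"
      by (intro integrable_const_bound) auto
    show "AE x in M. integrable M (\<lambda>y. F (x, y))"
      using indicator_mult_integrable[OF g] by (simp add: F_def M_def)
  qed
  have "(LINT x|M. deriv \<phi> x * (LINT y|M. indicator {..<x} y * g y)) = (LINT x|M. LINT y|M. F (x, y))"
    by (simp add: F_def)
  also have "\<dots> = (LINT y|M. LINT x|M. F (x, y))"
    using Fubini_integral[of "\<lambda>x y. F (x, y)"] intF by simp
  also have "\<dots> = (LINT y|M. - (\<phi> y * g y))"
  proof (rule Bochner_Integration.integral_cong[OF refl])
    fix y assume "y \<in> space M"
    then have "(LINT x|M. deriv \<phi> x * indicator {..<x} y) = - \<phi> y"
      unfolding M_def by (intro test_function_integral_deriv_Ioi \<phi>) (simp add: space_restrict_space)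
    moreover have "(LINT x|M. F (x, y)) = (LINT x|M. deriv \<phi> x * indicator {..<x} y * g y)"
      by (simp add: F_def mult.assoc)
    ultimately show "(LINT x|M. F (x, y)) = - (\<phi> y * g y)" by simp
  qed
  finally show ?thesis by (simp add: M_def)
qed

text \<open>For integrable scalar functions the gauge integrals in the definition exist and equal
  the Lebesgue integrals, which eliminates the witness \<open>I\<close>.\<close>

lemma weak_derivative_iff:
  fixes f g :: "real \<Rightarrow> real"
  assumes f: "integrable (lebesgue_on {a<..<b}) f" and g: "integrable (lebesgue_on {a<..<b}) g"
  shows "weak_derivative a b f g \<longleftrightarrow> (\<forall>\<phi>. test_function a b \<phi> \<longrightarrow>
    (LINT x|lebesgue_on {a<..<b}. \<phi> x * g x) = - (LINT x|lebesgue_on {a<..<b}. deriv \<phi> x * f x))"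
proof -
  have "(\<exists>I. ((\<lambda>x. deriv \<phi> x *\<^sub>R f x) has_integral I) {a..b} \<and>
           ((\<lambda>x. \<phi> x *\<^sub>R g x) has_integral - I) {a..b}) \<longleftrightarrow>
    (LINT x|lebesgue_on {a<..<b}. \<phi> x * g x) = - (LINT x|lebesgue_on {a<..<b}. deriv \<phi> x * f x)"
    if "test_function a b \<phi>" for \<phi>
    using has_integral_Icc_lebesgue_on[OF test_function_mult_integrable[OF g that]]
      has_integral_Icc_lebesgue_on[OF test_function_mult_integrable[OF f test_function_deriv[OF that]]]
    by (auto simp: has_integral_unique dest: has_integral_unique intro!: exI)
  then show ?thesis by (auto simp: weak_derivative_def)
qed

text \<open>By integration by parts the primitive \<open>G\<close> of \<open>g\<close> also has the
  weak derivative \<open>g\<close>, so \<open>f - G\<close> is annihilated by every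
  \<open>deriv \<phi>\<close> and is constant.\<close>

lemma weak_derivative_imp_primitive:
  fixes f g :: "real \<Rightarrow> real"
  assumes f: "integrable (lebesgue_on {a<..<b}) f" and g: "integrable (lebesgue_on {a<..<b}) g"
    and w: "weak_derivative a b f g" and "a < b"
  shows "\<exists>c. AE x in lebesgue_on {a<..<b}.
    f x = c + (LINT y|lebesgue_on {a<..<b}. indicator {..<x} y * g y)"
proof -
  define G where "G x = (LINT y|lebesgue_on {a<..<b}. indicator {..<x} y * g y)" for x
  have G: "integrable (lebesgue_on {a<..<b}) G"
    unfolding G_def[abs_def] by (rule integrable_primitive[OF g])
  have "\<exists>c. AE x in lebesgue_on {a<..<b}. f x - G x = c"
  proof (rule AE_const_if_test_function_deriv_integrals_zero)
    fix \<phi> assume \<phi>: "test_function a b \<phi>"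
    have "(LINT x|lebesgue_on {a<..<b}. deriv \<phi> x * (f x - G x)) =
        (LINT x|lebesgue_on {a<..<b}. deriv \<phi> x * f x) - (LINT x|lebesgue_on {a<..<b}. deriv \<phi> x * G x)"
      using test_function_mult_integrable[OF f test_function_deriv[OF \<phi>]]
        test_function_mult_integrable[OF G test_function_deriv[OF \<phi>]]
      by (simp add: right_diff_distrib)
    also have "\<dots> = 0"
      using w \<phi> test_function_integral_by_parts[OF g \<phi>]
      unfolding weak_derivative_iff[OF f g] by (simp add: G_def)
    finally show "(LINT x|lebesgue_on {a<..<b}. deriv \<phi> x * (f x - G x)) = 0" .
  qed (use f G \<open>a < b\<close> in auto)
  then obtain c where "AE x in lebesgue_on {a<..<b}. f x - G x = c" by blast
  then have "AE x in lebesgue_on {a<..<b}. f x = c + G x" by eventually_elim simp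
  then show ?thesis by (auto simp: G_def)
qed

lemma weak_derivative_unique:
  fixes f g g' :: "real \<Rightarrow> real"
  assumes "integrable (lebesgue_on {a<..<b}) f" "integrable (lebesgue_on {a<..<b}) g"
    "integrable (lebesgue_on {a<..<b}) g'" "weak_derivative a b f g" "weak_derivative a b f g'"
  shows "AE x in lebesgue_on {a<..<b}. g x = g' x"
proof -
  have "AE x in lebesgue_on {a<..<b}. g x - g' x = 0"
  proof (rule AE_zero_if_test_function_integrals_zero)
    fix \<phi> assume "test_function a b \<phi>"
    then show "(LINT x|lebesgue_on {a<..<b}. \<phi> x * (g x - g' x)) = 0"
      using assms test_function_mult_integrable[OF assms(2)] test_function_mult_integrable[OF assms(3)]
      by (simp add: weak_derivative_iff right_diff_distrib)
  qed (use assms in auto)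
  then show ?thesis by simp
qed

lemma weak_derivative_cong_AE:
  fixes f g f' g' :: "real \<Rightarrow> 'a::real_normed_vector"
  assumes "AE x in lebesgue_on {a<..<b}. f x = f' x" "AE x in lebesgue_on {a<..<b}. g x = g' x"
    and w: "weak_derivative a b f g"
  shows "weak_derivative a b f' g'"
proof -
  have "AE x in lebesgue_on {a<..<b}. f x = f' x \<and> g x = g' x"
    using assms(1,2) by eventually_elim simp
  then have "AE x in lebesgue. x \<in> {a<..<b} \<longrightarrow> f x = f' x \<and> g x = g' x"
    by (subst (asm) AE_restrict_space_iff) auto
  then obtain N where N: "N \<in> null_sets lebesgue" "{x. \<not> (x \<in> {a<..<b} \<longrightarrow> f x = f' x \<and> g x = g' x)} \<subseteq> N"
    by (auto simp: eventually_ae_filter)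
  \<comment> \<open>The definition integrates over the closed interval, the hypotheses speak of the
    open one; the two end points join the null set.\<close>
  define N' where "N' = insert a (insert b N)"
  have neg: "negligible N'" using N(1) by (simp add: N'_def negligible_iff_null_sets)
  have eq: "f' x = f x" "g' x = g x" if "x \<in> {a..b} - N'" for x
  proof -
    have "x \<in> {a<..<b}" "x \<notin> N" using that by (auto simp: N'_def)
    then have "f x = f' x \<and> g x = g' x" using N(2) by blast
    then show "f' x = f x" "g' x = g x" by auto
  qed
  show ?thesis unfolding weak_derivative_def
  proof (intro allI impI)
    fix \<phi> assume "test_function a b \<phi>"
    then obtain I where I: "((\<lambda>x. deriv \<phi> x *\<^sub>R f x) has_integral I) {a..b}"
        "((\<lambda>x. \<phi> x *\<^sub>R g x) has_integral - I) {a..b}"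
      using w unfolding weak_derivative_def by blast
    have "((\<lambda>x. deriv \<phi> x *\<^sub>R f' x) has_integral I) {a..b}"
      by (rule has_integral_spike[OF neg _ I(1)]) (simp add: eq)
    moreover have "((\<lambda>x. \<phi> x *\<^sub>R g' x) has_integral - I) {a..b}"
      by (rule has_integral_spike[OF neg _ I(2)]) (simp add: eq)
    ultimately show "\<exists>I. ((\<lambda>x. deriv \<phi> x *\<^sub>R f' x) has_integral I) {a..b} \<and>
           ((\<lambda>x. \<phi> x *\<^sub>R g' x) has_integral - I) {a..b}" by blast
  qed
qed

lemma weak_derivative_cong_AE_right:
  fixes f g g' :: "real \<Rightarrow> 'a::real_normed_vector"
  assumes "weak_derivative a b f g" "AE x in lebesgue_on {a<..<b}. g x = g' x"
  shows "weak_derivative a b f g'"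
  by (rule weak_derivative_cong_AE[OF _ assms(2,1)]) simp

section \<open>Continuous representatives and orthonormal expansions\<close>

text \<open>\<open>f\<close> agrees almost everywhere with a primitive of \<open>F\<close>, and by
  continuity everywhere, end points included. The fundamental theorem then gives the derivative,
  one-sided at the ends.\<close>

lemma weak_derivative_continuous_imp_DERIV:
  fixes f F :: "real \<Rightarrow> real"
  assumes "a < b" and f: "continuous_on {a..b} f" and F: "continuous_on {a..b} F"
    and w: "weak_derivative a b f F" and t: "t \<in> {a..b}"
  shows "(f has_real_derivative F t) (at t within {a..b})"
proof -
  have int: "integrable (lebesgue_on {a<..<b}) g" if "continuous_on {a..b} g" for g :: "real \<Rightarrow> real"
  proof -
    have "g absolutely_integrable_on {a..b}"
      using that by (rule absolutely_integrable_continuous_real)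
    then have "g absolutely_integrable_on {a<..<b}"
      by (simp add: absolutely_integrable_on_Icc_iff_Ioo)
    then show ?thesis
      by (simp add: integrable_restrict_space set_integrable_def)
  qed
  obtain c where c: "AE x in lebesgue_on {a<..<b}.
      f x = c + (LINT y|lebesgue_on {a<..<b}. indicator {..<x} y * F y)"
    using weak_derivative_imp_primitive[OF int[OF f] int[OF F] w \<open>a < b\<close>] by blast
  define h where "h x = f x - (c + integral {a..x} F)" for x
  have prim: "(LINT y|lebesgue_on {a<..<b}. indicator {..<x} y * F y) = integral {a..x} F"
    if x: "x \<in> {a<..<b}" for x
  proof -
    have "F integrable_on {a..x}"
      by (rule integrable_continuous_real) (use F x in \<open>auto intro: continuous_on_subset\<close>)
    then have "(F has_integral integral {a..x} F) {a<..<x}"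
      by (simp add: has_integral_Icc_iff_Ioo[symmetric] integrable_integral)
    then have "((\<lambda>y. if y \<in> {a<..<x} then F y else 0) has_integral integral {a..x} F) {a<..<b}"
      using x by (subst has_integral_restrict) auto
    then have "((\<lambda>y. indicator {..<x} y * F y) has_integral integral {a..x} F) {a<..<b}"
      by (rule has_integral_eq[rotated]) (auto simp: indicator_def)
    moreover have "((\<lambda>y. indicator {..<x} y * F y) has_integral
        (LINT y|lebesgue_on {a<..<b}. indicator {..<x} y * F y)) {a<..<b}"
      using has_integral_Icc_lebesgue_on[OF indicator_mult_integrable[OF int[OF F]]]
      by (simp add: has_integral_Icc_iff_Ioo)
    ultimately show ?thesis by (rule has_integral_unique[symmetric])
  qed
  have "AE x in lebesgue_on {a<..<b}. x \<in> {a<..<b}"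
    by (rule AE_I2) (simp add: space_restrict_space)
  with c have ae: "AE x in lebesgue_on {a<..<b}. \<bar>h x\<bar> = 0"
    by eventually_elim (simp add: h_def prim)
  have h: "continuous_on {a..b} h"
    unfolding h_def using f integrable_continuous_real[OF F]
    by (intro continuous_intros indefinite_integral_continuous_1) auto
  have "(LINT x|lebesgue_on {a<..<b}. \<bar>h x\<bar>) = (LINT x|lebesgue_on {a<..<b}. 0)"
    using int[OF continuous_on_rabs[OF h]] ae by (intro integral_cong_AE) auto
  then have "((\<lambda>x. \<bar>h x\<bar>) has_integral 0) {a..b}"
    using has_integral_Icc_lebesgue_on[OF int[OF continuous_on_rabs[OF h]]] by simp
  then have zero: "h x = 0" if "x \<in> {a..b}" for x
    using has_integral_0_cbox_imp_0[of a b "\<lambda>x. \<bar>h x\<bar>" x] continuous_on_rabs[OF h] that \<open>a < b\<close>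
    by auto
  have "((\<lambda>x. c + integral {a..x} F) has_real_derivative F t) (at t within {a..b})"
    using integral_has_real_derivative[OF F t] by (auto intro!: derivative_eq_intros)
  then show ?thesis
    unfolding has_real_derivative_iff_has_vector_derivative
    by (rule has_vector_derivative_transform[OF t, rotated]) (use zero in \<open>auto simp: h_def\<close>)
qed

text \<open>Applied to inner products with fixed vectors, this reduces vector-valued weak
  derivatives to the scalar theory.\<close>

lemma weak_derivative_bounded_linear:
  assumes "weak_derivative a b f g" "bounded_linear L"
  shows "weak_derivative a b (\<lambda>x. L (f x)) (\<lambda>x. L (g x))"
  unfolding weak_derivative_def
proof (intro allI impI)
  interpret bounded_linear L by fact
  fix \<phi> assume "test_function a b \<phi>"
  then obtain I where "((\<lambda>x. deriv \<phi> x *\<^sub>R f x) has_integral I) {a..b}"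
      "((\<lambda>x. \<phi> x *\<^sub>R g x) has_integral - I) {a..b}"
    using assms unfolding weak_derivative_def by blast
  from has_integral_linear[OF this(1) assms(2)] has_integral_linear[OF this(2) assms(2)]
  show "\<exists>I. ((\<lambda>x. deriv \<phi> x *\<^sub>R L (f x)) has_integral I) {a..b} \<and>
           ((\<lambda>x. \<phi> x *\<^sub>R L (g x)) has_integral - I) {a..b}"
    by (auto simp: o_def scaleR neg)
qed

text \<open>Gram-Schmidt, with the expansion formula as the invariant instead of orthonormality: the
  sum over \<open>E\<close> is a self-adjoint operation, and this already makes the residual
  \<open>r\<close> orthogonal to \<open>span B\<close>.\<close>

lemma span_orthonormal_expansion:
  fixes B :: "'a::real_inner set"
  assumes "finite B"
  shows "\<exists>E. finite E \<and> E \<subseteq> span B \<and> (\<forall>x\<in>span B. x = (\<Sum>e\<in>E. inner x e *\<^sub>R e))"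
  using assms
proof induction
  case empty
  then show ?case by (intro exI[of _ "{}"]) auto
next
  case (insert b B)
  then obtain E where E: "finite E" "E \<subseteq> span B" "\<And>x. x \<in> span B \<Longrightarrow> (\<Sum>e\<in>E. inner x e *\<^sub>R e) = x"
    by metis
  define r where "r = b - (\<Sum>e\<in>E. inner b e *\<^sub>R e)"
  have orth: "inner r y = 0" if "y \<in> span B" for y
  proof -
    have "inner (\<Sum>e\<in>E. inner b e *\<^sub>R e) y = inner b (\<Sum>e\<in>E. inner y e *\<^sub>R e)"
      by (simp add: inner_sum_left inner_sum_right inner_commute mult.commute)
    then show ?thesis using E(3)[OF that] by (simp add: r_def inner_diff_left)
  qed
  have sumE: "(\<Sum>e\<in>E. inner b e *\<^sub>R e) \<in> span B"
    using E(2) by (intro span_sum span_scale) auto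
  have rspan: "r \<in> span (insert b B)"
    unfolding r_def using sumE span_mono[of B "insert b B"]
    by (intro span_diff) (auto intro: span_base)
  have dec: "\<exists>y k. y \<in> span B \<and> x = y + k *\<^sub>R r" if "x \<in> span (insert b B)" for x
  proof -
    obtain k where k: "x - k *\<^sub>R b \<in> span B" using \<open>x \<in> span (insert b B)\<close> span_breakdown_eq by blast
    have "x = (x - k *\<^sub>R b + k *\<^sub>R (\<Sum>e\<in>E. inner b e *\<^sub>R e)) + k *\<^sub>R r"
      by (simp add: r_def algebra_simps)
    then show ?thesis using k sumE by (metis span_add span_scale)
  qed
  show ?case
  proof (cases "r = 0")
    case True
    then have "span (insert b B) \<subseteq> span B" using dec by fastforce
    then show ?thesis using E span_mono[of B "insert b B"] by (intro exI[of _ E]) auto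
  next
    case False
    define q where "q = inverse (norm r) *\<^sub>R r"
    have qE: "q \<notin> E"
    proof
      assume "q \<in> E"
      then have "inner r q = 0" using E(2) orth by auto
      then show False using False by (simp add: q_def)
    qed
    have "(\<Sum>e\<in>insert q E. inner x e *\<^sub>R e) = x" if x: "x \<in> span (insert b B)" for x
    proof -
      obtain y k where y: "y \<in> span B" "x = y + k *\<^sub>R r" using dec[OF x] by blast
      have "(\<Sum>e\<in>E. inner x e *\<^sub>R e) = (\<Sum>e\<in>E. inner y e *\<^sub>R e)"
        using E(2) orth y by (intro sum.cong) (auto simp: inner_add_left)
      also have "\<dots> = y" by (rule E(3)[OF y(1)])
      finally have "(\<Sum>e\<in>E. inner x e *\<^sub>R e) = y" .
      moreover have "inner x q *\<^sub>R q = k *\<^sub>R r"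
      proof -
        have "inner y r = 0" using orth[OF y(1)] by (simp add: inner_commute)
        then have "inner x q *\<^sub>R q = (inverse (norm r) * (k * (norm r)\<^sup>2) * inverse (norm r)) *\<^sub>R r"
          by (simp add: y q_def inner_add_left power2_norm_eq_inner)
        also have "inverse (norm r) * (k * (norm r)\<^sup>2) * inverse (norm r) = k"
          using False by (simp add: power2_eq_square)
        finally show ?thesis .
      qed
      ultimately show ?thesis using qE E(1) y by (simp add: add.commute)
    qed
    moreover have "insert q E \<subseteq> span (insert b B)"
      using E(2) span_mono[of B "insert b B"] rspan by (auto simp: q_def intro: span_scale)
    ultimately show ?thesis using E(1) by (intro exI[of _ "insert q E"]) auto
  qed
qed

lemma finite_dim_orthonormal_expansion:
  fixes S :: "'a::real_inner set"
  assumes "finite_dim_subspace S"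
  obtains E where "finite E" "E \<subseteq> S" "\<And>x. x \<in> S \<Longrightarrow> (\<Sum>e\<in>E. inner x e *\<^sub>R e) = x"
  using assms span_orthonormal_expansion unfolding finite_dim_subspace_def by metis

section \<open>The energy estimate in an abstract inner product space\<close>

lemma decay_rate_pos:
  assumes "0 < a0" "a0 \<le> a1" shows "0 < decay_rate a0 a1"
  using assms unfolding decay_rate_def
  by (intro mult_pos_pos divide_pos_pos add_pos_pos) auto

text \<open>
  In the next two lemmas \<open>x\<close> and \<open>y\<close> are the norms of \<open>u\<close> and \<open>p\<close>, and \<open>y + x / a0\<close> bounds the norm
  of the antiderivative \<open>U\<close> of \<open>u\<close>. The Lyapunov parameter is \<open>\<epsilon> = 3/2 * decay_rate a0 a1\<close>.
\<close>

lemma lyapunov_perturbation_bound: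
  fixes a0 a1 x y :: real
  assumes "0 < a0" "a0 \<le> a1" "0 \<le> x" "0 \<le> y"
  shows "3/2 * decay_rate a0 a1 * (x * (y + x / a0)) \<le> (x\<^sup>2 + y\<^sup>2) / 4"
proof -
  define \<epsilon> where "\<epsilon> = 3/2 * decay_rate a0 a1"
  define d where "d = 8 * a0\<^sup>2 + 4 * a0\<^sup>2 * a1 + 2 * a0 * a1 + a1 ^ 4"
  have d: "0 < d" unfolding d_def using assms by (intro add_pos_pos) auto
  have eps: "\<epsilon> = 2 * a0 ^ 3 / d" by (simp add: \<epsilon>_def decay_rate_def d_def[symmetric])
  have eps0: "0 < \<epsilon>" using d assms by (simp add: eps)
  \<comment> \<open>The requirement eps (1/2 + 1/a0) <= 1/4 is equivalent to d >= 8 a0^2 + 4 a0^3;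
    the first two terms of \<open>d\<close> provide it because \<open>a0 \<le> a1\<close>.\<close>
  have "4 * a0\<^sup>2 * a0 \<le> 4 * a0\<^sup>2 * a1" using assms by (intro mult_left_mono) auto
  moreover have "0 \<le> 2 * a0 * a1" "0 \<le> a1 ^ 4" using assms by auto
  moreover have "4 * a0 ^ 3 = 4 * a0\<^sup>2 * a0" by (simp add: power3_eq_cube power2_eq_square)
  ultimately have "4 * a0 ^ 3 + 8 * a0\<^sup>2 \<le> d"
    unfolding d_def by linarith
  then have "(4 * a0 ^ 3 + 8 * a0\<^sup>2) / d / 4 \<le> 1/4"
    using d by simp
  also have "(4 * a0 ^ 3 + 8 * a0\<^sup>2) / d / 4 = \<epsilon> * (1/2 + 1/a0)"
    unfolding eps using d assms by (simp add: field_simps power3_eq_cube power2_eq_square)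
  finally have "\<epsilon> * (1/2 + 1/a0) \<le> 1/4" .
  have e1: "\<epsilon> / 2 \<le> 1/4" 
    using \<open>\<epsilon> * (1/2 + 1/a0) \<le> 1/4\<close> eps0 assms by (simp add: distrib_left) (smt (verit) divide_pos_pos)
  have "2 * (x * y) \<le> x\<^sup>2 + y\<^sup>2" using sum_squares_bound[of x y] by simp
  then have "\<epsilon> * (x * y) \<le> \<epsilon> * (x\<^sup>2 / 2 + y\<^sup>2 / 2)" using eps0 by (intro mult_left_mono) auto
  then have "\<epsilon> * (x * (y + x / a0)) \<le> \<epsilon> * (1/2 + 1/a0) * x\<^sup>2 + \<epsilon> / 2 * y\<^sup>2"
    by (simp add: power2_eq_square algebra_simps)
  also have "\<dots> \<le> 1/4 * x\<^sup>2 + 1/4 * y\<^sup>2"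
    by (intro add_mono mult_right_mono \<open>\<epsilon> * (1/2 + 1/a0) \<le> 1/4\<close> e1) auto
  finally show ?thesis unfolding \<epsilon>_def by (simp add: add_divide_distrib)
qed

lemma lyapunov_dissipation_bound:
  fixes a0 a1 x y :: real
  assumes "0 < a0" "a0 \<le> a1" "0 \<le> x" "0 \<le> y"
  shows "- (a0 * x\<^sup>2) + 3/2 * decay_rate a0 a1 * (- y\<^sup>2 + a1 * x * (y + x / a0) + x\<^sup>2)
    \<le> - (3/2 * decay_rate a0 a1 * ((x\<^sup>2 + y\<^sup>2) / 2))"
proof -
  define \<epsilon> where "\<epsilon> = 3/2 * decay_rate a0 a1"
  define d where "d = 8 * a0\<^sup>2 + 4 * a0\<^sup>2 * a1 + 2 * a0 * a1 + a1 ^ 4"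
  have d: "0 < d" unfolding d_def using assms by (intro add_pos_pos) auto
  have eps: "\<epsilon> = 2 * a0 ^ 3 / d" by (simp add: \<epsilon>_def decay_rate_def d_def[symmetric])
  have eps0: "0 < \<epsilon>" using d assms by (simp add: eps)
  \<comment> \<open>The requirement eps (3/2 + a1/a0 + a1^2/2) <= a0 is equivalent to d >= 3 a0^2 +
    2 a0 a1 + a0^2 a1^2; the term a1^4 of \<open>d\<close> covers the last summand.\<close>
  have "a0\<^sup>2 * a1\<^sup>2 \<le> a1\<^sup>2 * a1\<^sup>2" using assms by (intro mult_right_mono power_mono) auto
  moreover have "0 \<le> 5 * a0\<^sup>2 + 4 * a0\<^sup>2 * a1" using assms by auto
  ultimately have "3 * a0\<^sup>2 + 2 * a0 * a1 + a0\<^sup>2 * a1\<^sup>2 \<le> d"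
    unfolding d_def by (simp add: power4_eq_xxxx power2_eq_square)
  then have "a0 * ((3 * a0\<^sup>2 + 2 * a0 * a1 + a0\<^sup>2 * a1\<^sup>2) / d) \<le> a0 * 1"
    using assms d by (intro mult_left_mono) auto
  also have "a0 * ((3 * a0\<^sup>2 + 2 * a0 * a1 + a0\<^sup>2 * a1\<^sup>2) / d) = \<epsilon> * (3/2 + a1/a0 + a1\<^sup>2/2)"
    unfolding eps using d assms by (simp add: field_simps power3_eq_cube power2_eq_square)
  finally have key: "\<epsilon> * (3/2 + a1/a0 + a1\<^sup>2/2) \<le> a0" by simp
  \<comment> \<open>Young's inequality is balanced to consume half of - y^2; the other half is the
    share of p in the energy.\<close>
  have "2 * (a1 * x) * y \<le> (a1 * x)\<^sup>2 + y\<^sup>2" by (rule sum_squares_bound)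
  then have xy: "a1 * x * y \<le> a1\<^sup>2 / 2 * x\<^sup>2 + y\<^sup>2 / 2" by (simp add: power_mult_distrib)
  have "- y\<^sup>2 + a1 * x * (y + x / a0) + x\<^sup>2 = - y\<^sup>2 + a1 * x * y + a1 / a0 * x\<^sup>2 + x\<^sup>2"
    by (simp add: power2_eq_square algebra_simps)
  also have "\<dots> = (3/2 + a1/a0 + a1\<^sup>2/2) * x\<^sup>2 - (x\<^sup>2 + y\<^sup>2) / 2 - (a1\<^sup>2 / 2 * x\<^sup>2 + y\<^sup>2 / 2 - a1 * x * y)"
    by (simp add: ring_distribs add_divide_distrib)
  also have "\<dots> \<le> (3/2 + a1/a0 + a1\<^sup>2/2) * x\<^sup>2 - (x\<^sup>2 + y\<^sup>2) / 2"
    using xy by simp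
  finally have "\<epsilon> * (- y\<^sup>2 + a1 * x * (y + x / a0) + x\<^sup>2)
      \<le> \<epsilon> * ((3/2 + a1/a0 + a1\<^sup>2/2) * x\<^sup>2 - (x\<^sup>2 + y\<^sup>2) / 2)"
    using eps0 by (intro mult_left_mono) auto
  also have "\<dots> = \<epsilon> * (3/2 + a1/a0 + a1\<^sup>2/2) * x\<^sup>2 - \<epsilon> * ((x\<^sup>2 + y\<^sup>2) / 2)"
    by (simp add: algebra_simps)
  also have "\<dots> \<le> a0 * x\<^sup>2 - \<epsilon> * ((x\<^sup>2 + y\<^sup>2) / 2)"
    using mult_right_mono[OF key, of "x\<^sup>2"] by simp
  finally show ?thesis unfolding \<epsilon>_def by linarith
qed

text \<open>
  \<open>D\<close> stands for the weak derivative, \<open>M\<close> for the multiplication by the coefficient \<open>a\<close>, and \<open>e1\<close> for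
  the constant function 1.
\<close>

locale damped_wave_galerkin =
  fixes V Q :: "'a::real_inner set" and D M :: "'a \<Rightarrow> 'a" and e1 :: 'a and a0 a1 :: real
  assumes V: "finite_dim_subspace V" and Q: "finite_dim_subspace Q" "Q = D ` V"
    and D_add: "\<And>v w. v \<in> V \<Longrightarrow> w \<in> V \<Longrightarrow> D (v + w) = D v + D w"
    and D_scaleR: "\<And>c v. v \<in> V \<Longrightarrow> D (c *\<^sub>R v) = c *\<^sub>R D v"
    and M_bounded_linear: "bounded_linear M"
    and M_sym: "\<And>x y. inner (M x) y = inner x (M y)"
    and M_coercive: "\<And>x. a0 * (norm x)\<^sup>2 \<le> inner (M x) x"
    and M_bound: "\<And>x. norm (M x) \<le> a1 * norm x"
    and one: "e1 \<in> V" "D e1 = 0" "norm e1 = 1"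
    and poincare: "\<And>v. v \<in> V \<Longrightarrow> norm v \<le> norm (D v) + \<bar>inner (M v) e1\<bar> / a0"
    and a0: "0 < a0" "a0 \<le> a1"
begin

lemma V_subspace: "subspace V" using V by (simp add: finite_dim_subspace_def)

lemma D_sum:
  assumes "finite E" "\<omega> ` E \<subseteq> V"
  shows "D (\<Sum>e\<in>E. c e *\<^sub>R \<omega> e) = (\<Sum>e\<in>E. c e *\<^sub>R D (\<omega> e))"
  using assms
proof induction
  case empty
  then show ?case using D_scaleR[OF one(1), of 0] by simp
next
  case (insert e E)
  moreover have "(\<Sum>e\<in>E. c e *\<^sub>R \<omega> e) \<in> V"
    using insert by (intro subspace_sum subspace_scale V_subspace) auto
  ultimately show ?case
    by (simp add: D_add D_scaleR subspace_scale V_subspace)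
qed

lemma D_diff: "v \<in> V \<Longrightarrow> w \<in> V \<Longrightarrow> D (v - w) = D v - D w"
  using D_add[of v "- 1 *\<^sub>R w"] D_scaleR[of w "-1"] by (simp add: V_subspace subspace_neg)

text \<open>The strong form of the system. The second equation can be stated untested because
  \<open>D\<close> maps \<open>V\<close> into \<open>Q\<close>. The derivatives are arguments so
  that they can in turn serve as a solution.\<close>

definition solution where
  "solution T u p u' p' \<longleftrightarrow> (\<forall>t\<in>{0..T}. u t \<in> V \<and> p t \<in> Q \<and> u' t \<in> V \<and>
    (u has_vector_derivative u' t) (at t within {0..T}) \<and>
    (p has_vector_derivative p' t) (at t within {0..T}) \<and>
    (\<forall>v\<in>V. inner (u' t) v - inner (p t) (D v) + inner (M (u t)) v = 0) \<and> p' t = - D (u t))"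

lemma solution_cong:
  assumes "solution T u p u' p'" "\<And>t. t \<in> {0..T} \<Longrightarrow> w t = u t" "\<And>t. t \<in> {0..T} \<Longrightarrow> q t = p t"
  shows "solution T w q u' p'"
  unfolding solution_def
proof (intro ballI)
  fix t assume t: "t \<in> {0..T}"
  have "(w has_vector_derivative u' t) (at t within {0..T})"
    "(q has_vector_derivative p' t) (at t within {0..T})"
    by (rule has_vector_derivative_transform[OF t], use assms t in \<open>auto simp: solution_def\<close>)+
  then show "w t \<in> V \<and> q t \<in> Q \<and> u' t \<in> V \<and>
      (w has_vector_derivative u' t) (at t within {0..T}) \<and>
      (q has_vector_derivative p' t) (at t within {0..T}) \<and>
      (\<forall>v\<in>V. inner (u' t) v - inner (q t) (D v) + inner (M (w t)) v = 0) \<and> p' t = - D (w t)"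
    using assms t unfolding solution_def by simp
qed

text \<open>On V x Q the system reads z' = A z with the bounded linear map A = (\<open>A1\<close>,
  \<open>A2\<close>). Hence z' = A z is differentiable with derivative A z', and z' solves the same
  system.\<close>

lemma solution_deriv:
  assumes "solution T u p u' p'"
  shows "\<exists>u'' p''. solution T u' p' u'' p''"
proof -
  obtain E where E: "finite E" "E \<subseteq> V" "\<And>x. x \<in> V \<Longrightarrow> (\<Sum>e\<in>E. inner x e *\<^sub>R e) = x"
    using finite_dim_orthonormal_expansion[OF V] by blast
  note sol = assms[unfolded solution_def, rule_format]
  have DE: "D v = (\<Sum>e\<in>E. inner v e *\<^sub>R D e)" if "v \<in> V" for v
    using D_sum[OF E(1), of "\<lambda>e. e" "inner v"] E(2) E(3)[OF that] by simp
  \<comment> \<open>\<open>D\<close> need not be bounded on the whole space; the expansion along \<open>E\<close> replaces it by a bounded operator\<close>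
  define A1 where "A1 z = (\<Sum>e\<in>E. (inner (snd z) (D e) - inner (fst z) (M e)) *\<^sub>R e)" for z :: "'a \<times> 'a"
  define A2 where "A2 z = - (\<Sum>e\<in>E. inner (fst z) e *\<^sub>R D e)" for z :: "'a \<times> 'a"
  have bl: "bounded_linear A1" "bounded_linear A2"
    unfolding A1_def[abs_def] A2_def[abs_def]
    by (intro bounded_linear_minus bounded_linear_sum bounded_linear_scaleR_const bounded_linear_sub
        bounded_linear_inner_left_comp bounded_linear_fst bounded_linear_snd)+
  have A1V: "A1 z \<in> V" for z
    unfolding A1_def using E(2) by (intro subspace_sum subspace_scale V_subspace) auto
  \<comment> \<open>\<open>A1 (x, y)\<close> is the Riesz representative in \<open>V\<close> of the
    functional v -> (y, D v) - (M x, v), assembled from its values on \<open>E\<close>.\<close>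
  have A1: "inner (A1 (x, y)) v - inner y (D v) + inner (M x) v = 0" if v: "v \<in> V" for x y v
  proof -
    have "inner (A1 (x, y)) v = (\<Sum>e\<in>E. inner y (D e) * inner e v) - (\<Sum>e\<in>E. inner x (M e) * inner e v)"
      by (simp add: A1_def inner_sum_left left_diff_distrib sum_subtractf)
    also have "(\<Sum>e\<in>E. inner y (D e) * inner e v) = inner y (D v)"
      unfolding DE[OF v] by (simp add: inner_sum_right mult.commute inner_commute[of v])
    also have "(\<Sum>e\<in>E. inner x (M e) * inner e v) = inner (M x) (\<Sum>e\<in>E. inner v e *\<^sub>R e)"
      by (simp add: inner_sum_right mult.commute M_sym inner_commute[of v])
    finally show ?thesis using E(3)[OF v] by simp
  qed
  have u': "u' t = A1 (u t, p t)" if t: "t \<in> {0..T}" for t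
  proof -
    have *: "inner (u' t) v - inner (p t) (D v) + inner (M (u t)) v = 0" if "v \<in> V" for v
      using sol[OF t] that by blast
    have "inner (u' t) e = inner (p t) (D e) - inner (u t) (M e)" if "e \<in> E" for e
    proof -
      have "inner (u' t) e - inner (p t) (D e) + inner (M (u t)) e = 0" using * that E(2) by blast
      then show ?thesis unfolding M_sym by linarith
    qed
    then show ?thesis
      using E(3)[of "u' t"] sol[OF t] by (simp add: A1_def)
  qed
  have p': "p' t = A2 (u t, p t)" if t: "t \<in> {0..T}" for t
    using sol[OF t] DE[of "u t"] by (simp add: A2_def)
  have der: "((\<lambda>t. (u t, p t)) has_vector_derivative (u' t, p' t)) (at t within {0..T})"
    if "t \<in> {0..T}" for t
    using sol[OF that] by (intro has_vector_derivative_Pair) auto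
  have "solution T (\<lambda>t. A1 (u t, p t)) (\<lambda>t. A2 (u t, p t)) (\<lambda>t. A1 (u' t, p' t)) (\<lambda>t. A2 (u' t, p' t))"
    unfolding solution_def
  proof (intro ballI conjI)
    fix t assume t: "t \<in> {0..T}"
    show "A1 (u t, p t) \<in> V" "A1 (u' t, p' t) \<in> V" by (rule A1V)+
    have "A2 (u t, p t) = D (- u t)"
      using D_scaleR[of "u t" "-1"] sol[OF t] p'[OF t] by simp
    then show "A2 (u t, p t) \<in> Q"
      using sol[OF t] V_subspace by (auto simp: Q(2) subspace_neg)
    show "((\<lambda>t. A1 (u t, p t)) has_vector_derivative A1 (u' t, p' t)) (at t within {0..T})"
      "((\<lambda>t. A2 (u t, p t)) has_vector_derivative A2 (u' t, p' t)) (at t within {0..T})"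
      by (rule bounded_linear.has_vector_derivative[OF _ der[OF t]], rule bl)+
    show "inner (A1 (u' t, p' t)) v - inner (A2 (u t, p t)) (D v) + inner (M (A1 (u t, p t))) v = 0"
      if "v \<in> V" for v
      using A1[OF that, of "u' t" "p' t"] by (simp add: u'[OF t] p'[OF t])
    have "u' t \<in> V" using sol[OF t] by simp
    then show "A2 (u' t, p' t) = - D (A1 (u t, p t))"
      by (simp add: A2_def DE u'[OF t, symmetric])
  qed
  then show ?thesis
    using u' p' by (blast intro: solution_cong)
qed

text \<open>Since \<open>0 < T\<close>, derivatives within \<open>{0..T}\<close> are unique, so
  \<open>vector_derivative\<close> in \<open>dt\<close> returns the pair that belongs to the
  solution.\<close>

lemma solution_dt:
  assumes "solution T u p u' p'" "0 < T"
  shows "\<exists>w q. solution T (dt T k u) (dt T k p) w q"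
proof (induction k)
  case 0
  then show ?case using assms by auto
next
  case (Suc k)
  then obtain w q where wq: "solution T (dt T k u) (dt T k p) w q" by blast
  have "(dt T k u has_vector_derivative w t) (at t within {0..T})"
    "(dt T k p has_vector_derivative q t) (at t within {0..T})" if "t \<in> {0..T}" for t
    using wq that unfolding solution_def by blast+
  then have "vector_derivative (dt T k u) (at t within {0..T}) = w t"
    "vector_derivative (dt T k p) (at t within {0..T}) = q t" if "t \<in> {0..T}" for t
    using vector_derivative_within_cbox[OF \<open>0 < T\<close>, of t "dt T k u" "w t"]
      vector_derivative_within_cbox[OF \<open>0 < T\<close>, of t "dt T k p" "q t"] that by auto
  note vd = this
  obtain w' q' where "solution T w q w' q'" using solution_deriv[OF wq] by blast
  then have "solution T (dt T (Suc k) u) (dt T (Suc k) p) w' q'"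
    by (rule solution_cong) (simp_all add: vd)
  then show ?case by blast
qed

text \<open>
  \<open>U\<close> is fixed by \<open>D U = - p\<close> up to a constant, and the constant by testing with \<open>e1\<close>. The difference
  \<open>U' - u\<close> then satisfies the homogeneous versions of both conditions, so it vanishes by the
  Poincare inequality.
\<close>

lemma solution_antiderivative:
  assumes sol: "solution T u p u' p'"
  shows "\<exists>U. \<forall>t\<in>{0..T}. U t \<in> V \<and> D (U t) = - p t \<and>
    inner (M (U t)) e1 = - inner (u t) e1 \<and> (U has_vector_derivative u t) (at t within {0..T})"
proof -
  obtain C where C: "finite C" "C \<subseteq> Q" "\<And>x. x \<in> Q \<Longrightarrow> (\<Sum>e\<in>C. inner x e *\<^sub>R e) = x"
    using finite_dim_orthonormal_expansion[OF Q(1)] by blast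
  have "\<forall>q\<in>C. \<exists>v. v \<in> V \<and> D v = q" using C(2) Q(2) by auto
  then obtain \<omega> where \<omega>: "\<And>q. q \<in> C \<Longrightarrow> \<omega> q \<in> V" "\<And>q. q \<in> C \<Longrightarrow> D (\<omega> q) = q" by metis
  \<comment> \<open>On \<open>Q\<close> this is a linear right inverse of \<open>D\<close> up to
    sign: \<open>D (R (x, y)) = - y\<close>, from chosen preimages of the elements of
    \<open>C\<close>.\<close>
  define R where "R z = - (\<Sum>q\<in>C. inner (snd z) q *\<^sub>R \<omega> q)" for z :: "'a \<times> 'a"
  define m where "m = inner (M e1) e1"
  \<comment> \<open>Because \<open>D e1 = 0\<close>, subtracting a multiple of \<open>e1\<close>
    leaves \<open>D\<close> unchanged; the coefficient enforces
    \<open>inner (M (Z (x, y))) e1 = - inner x e1\<close>. As \<open>Z\<close> is bounded linear, U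
    inherits differentiability from (u, p).\<close>
  define Z where "Z z = R z - ((inner (fst z) e1 + inner (M (R z)) e1) / m) *\<^sub>R e1" for z
  note sol = sol[unfolded solution_def, rule_format]
  have m: "m > 0" using M_coercive[of e1] a0 by (simp add: m_def one)
  have blR: "bounded_linear R"
    unfolding R_def[abs_def]
    by (intro bounded_linear_minus bounded_linear_sum bounded_linear_scaleR_const
        bounded_linear_inner_left_comp bounded_linear_snd)
  have blZ: "bounded_linear Z"
    unfolding Z_def[abs_def] divide_inverse
    by (intro bounded_linear_sub bounded_linear_scaleR_const blR bounded_linear_mult_const
        bounded_linear_add bounded_linear_inner_left_comp bounded_linear_fst
        bounded_linear_compose[OF M_bounded_linear blR])
  have RV: "R z \<in> V" for z
    unfolding R_def using \<omega> by (intro subspace_neg subspace_sum subspace_scale V_subspace) auto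
  have DR: "D (R (x, y)) = - y" if "y \<in> Q" for x y
  proof -
    have "D (R (x, y)) = - D (\<Sum>q\<in>C. inner y q *\<^sub>R \<omega> q)"
      using D_scaleR[of "\<Sum>q\<in>C. inner y q *\<^sub>R \<omega> q" "-1"] \<omega>
      by (simp add: R_def subspace_sum subspace_scale V_subspace)
    also have "D (\<Sum>q\<in>C. inner y q *\<^sub>R \<omega> q) = (\<Sum>q\<in>C. inner y q *\<^sub>R q)"
      using C(1) \<omega> by (subst D_sum) auto
    finally show ?thesis using C(3)[OF that] by simp
  qed
  have ZV: "Z z \<in> V" for z
    unfolding Z_def by (intro subspace_diff subspace_scale V_subspace RV one)
  have DZ: "D (Z (x, y)) = - y" if "y \<in> Q" for x y
    using DR[OF that] one D_scaleR[OF one(1)]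
    by (simp add: Z_def D_diff RV subspace_scale V_subspace)
  have MZ: "inner (M (Z (x, y))) e1 = - inner x e1" for x y
  proof -
    interpret M: bounded_linear M by (rule M_bounded_linear)
    show ?thesis
      using m by (simp add: Z_def M.diff M.scaleR inner_diff_left m_def[symmetric])
  qed
  define U where "U t = Z (u t, p t)" for t
  have Q_p': "p' t \<in> Q" if "t \<in> {0..T}" for t
    using sol[OF that] D_scaleR[of "u t" "-1"] V_subspace Q(2) by (auto simp: subspace_neg image_iff intro!: bexI[of _ "- u t"])
  have der: "(U has_vector_derivative Z (u' t, p' t)) (at t within {0..T})" if "t \<in> {0..T}" for t
    unfolding U_def using sol[OF that]
    by (intro bounded_linear.has_vector_derivative[OF blZ] has_vector_derivative_Pair) auto
  have "Z (u' t, p' t) = u t" if t: "t \<in> {0..T}" for t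
  proof -
    interpret M: bounded_linear M by (rule M_bounded_linear)
    define x where "x = Z (u' t, p' t) - u t"
    have uV: "u t \<in> V" using sol[OF t] by simp
    have "D x = 0"
      unfolding x_def using DZ[OF Q_p'[OF t]] sol[OF t] by (simp add: D_diff ZV uV)
    \<comment> \<open>The first equation tested with \<open>e1\<close>, where the term with
      \<open>D e1\<close> drops out; it identifies the normalisation of
      \<open>Z (u' t, p' t)\<close> with \<open>inner (M (u t)) e1\<close>.\<close>
    moreover have "inner (u' t) e1 + inner (M (u t)) e1 = 0"
      using sol[OF t] one by (auto dest: bspec[of _ _ e1])
    then have "inner (M x) e1 = 0"
      by (simp add: x_def M.diff inner_diff_left MZ)
    moreover have "x \<in> V" unfolding x_def by (intro subspace_diff V_subspace ZV uV)
    ultimately have "norm x \<le> 0" using poincare[of x] by simp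
    then show ?thesis by (simp add: x_def)
  qed
  with der have "(U has_vector_derivative u t) (at t within {0..T})" if "t \<in> {0..T}" for t
    using that by metis
  moreover have "U t \<in> V" "D (U t) = - p t" "inner (M (U t)) e1 = - inner (u t) e1"
    if "t \<in> {0..T}" for t
    using sol[OF that] by (auto simp: U_def ZV DZ MZ)
  ultimately show ?thesis by (intro exI[of _ U] ballI conjI)
qed

section \<open>The Lyapunov functional and its decay\<close>

lemma has_real_derivative_inner:
  assumes "(f has_vector_derivative f') (at t within S)" "(g has_vector_derivative g') (at t within S)"
  shows "((\<lambda>t. inner (f t) (g t)) has_real_derivative inner (f t) g' + inner f' (g t)) (at t within S)"
  using bounded_bilinear.has_vector_derivative[OF bounded_bilinear_inner assms]
  by (simp add: has_real_derivative_iff_has_vector_derivative)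

lemma solution_energy_decay:
  assumes sol: "solution T u p u' p'" and st: "0 \<le> s" "s \<le> t" "t \<le> T"
  shows "((norm (u t))\<^sup>2 + (norm (p t))\<^sup>2) / 2 \<le>
    3 * exp (- decay_rate a0 a1 * (t - s)) * (((norm (u s))\<^sup>2 + (norm (p s))\<^sup>2) / 2)"
proof -
  define \<alpha> where "\<alpha> = decay_rate a0 a1"
  have \<alpha>: "0 < \<alpha>" using decay_rate_pos[OF a0] by (simp add: \<alpha>_def)
  obtain U where "\<forall>t\<in>{0..T}. U t \<in> V \<and> D (U t) = - p t \<and>
      inner (M (U t)) e1 = - inner (u t) e1 \<and> (U has_vector_derivative u t) (at t within {0..T})"
    using solution_antiderivative[OF sol] by (elim exE)
  then have U: "U t \<in> V" "D (U t) = - p t" "inner (M (U t)) e1 = - inner (u t) e1"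
    "(U has_vector_derivative u t) (at t within {0..T})" if "t \<in> {0..T}" for t
    using that by auto
  note sol = sol[unfolded solution_def, rule_format]
  define e where "e t = ((norm (u t))\<^sup>2 + (norm (p t))\<^sup>2) / 2" for t
  define L where "L t = e t + 3/2 * \<alpha> * inner (u t) (U t)" for t
  \<comment> \<open>The derivative of \<open>L\<close> after insertion of the equations: the
    coupling terms in the energy cancel, and testing with U gives (u', U) = - ||p||^2 - (M u,
    U).\<close>
  define L' where "L' t = - inner (M (u t)) (u t) +
    3/2 * \<alpha> * (- (norm (p t))\<^sup>2 - inner (M (u t)) (U t) + (norm (u t))\<^sup>2)" for t
  have U_norm: "norm (U t) \<le> norm (p t) + norm (u t) / a0" if t: "t \<in> {0..T}" for t
  proof -
    have "\<bar>inner (u t) e1\<bar> \<le> norm (u t)"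
      using Cauchy_Schwarz_ineq2[of "u t" e1] one by simp
    then have "\<bar>inner (u t) e1\<bar> / a0 \<le> norm (u t) / a0"
      using a0 by (simp add: divide_right_mono)
    then show ?thesis using poincare[OF U(1)[OF t]] U(2,3)[OF t] by simp
  qed
  have L_bounds: "e t / 2 \<le> L t" "L t \<le> 3/2 * e t" if t: "t \<in> {0..T}" for t
  proof -
    have "\<bar>inner (u t) (U t)\<bar> \<le> norm (u t) * norm (U t)" by (rule Cauchy_Schwarz_ineq2)
    also have "\<dots> \<le> norm (u t) * (norm (p t) + norm (u t) / a0)"
      by (intro mult_left_mono U_norm t) simp
    finally have "3/2 * \<alpha> * \<bar>inner (u t) (U t)\<bar> \<le> 3/2 * \<alpha> * (norm (u t) * (norm (p t) + norm (u t) / a0))"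
      using \<alpha> by (intro mult_left_mono) auto
    also have "\<dots> \<le> e t / 2"
      using lyapunov_perturbation_bound[OF a0, of "norm (u t)" "norm (p t)"]
      by (simp add: e_def \<alpha>_def)
    finally have "\<bar>3/2 * \<alpha> * inner (u t) (U t)\<bar> \<le> e t / 2"
      using \<alpha> by (simp add: abs_mult)
    then show "e t / 2 \<le> L t" "L t \<le> 3/2 * e t" by (auto simp: L_def)
  qed
  have L_deriv: "(L has_real_derivative L' t) (at t within {0..T})" if t: "t \<in> {0..T}" for t
  proof -
    have ut: "u t \<in> V" and du: "(u has_vector_derivative u' t) (at t within {0..T})"
      and dp: "(p has_vector_derivative p' t) (at t within {0..T})"
      and eq: "\<And>v. v \<in> V \<Longrightarrow> inner (u' t) v = inner (p t) (D v) - inner (M (u t)) v"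
      and p': "p' t = - D (u t)"
      using sol[OF t] by (auto simp: algebra_simps)
    have "(L has_real_derivative
      (1/2 * (inner (u t) (u' t) + inner (u' t) (u t)) + 1/2 * (inner (p t) (p' t) + inner (p' t) (p t)))
        + 3/2 * \<alpha> * (inner (u t) (u t) + inner (u' t) (U t))) (at t within {0..T})"
      unfolding L_def[abs_def] e_def power2_norm_eq_inner add_divide_distrib
      by (rule derivative_eq_intros has_real_derivative_inner du dp U(4) t refl | simp add: field_simps)+
    moreover have "inner (u' t) (u t) = inner (p t) (D (u t)) - inner (M (u t)) (u t)"
      "inner (u' t) (U t) = - inner (p t) (p t) - inner (M (u t)) (U t)"
      using eq[OF ut] eq[OF U(1)[OF t]] U(2)[OF t] by auto
    moreover have "inner (u t) (u' t) = inner (u' t) (u t)" "inner (p' t) (p t) = inner (p t) (p' t)"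
      by (rule inner_commute)+
    moreover have "inner (p t) (p' t) = - inner (p t) (D (u t))" by (simp add: p')
    ultimately show ?thesis
      by (simp only: L'_def power2_norm_eq_inner) (simp add: algebra_simps)
  qed
  have L'_le: "L' t \<le> - \<alpha> * L t" if t: "t \<in> {0..T}" for t
  proof -
    have "\<bar>inner (M (u t)) (U t)\<bar> \<le> norm (M (u t)) * norm (U t)" by (rule Cauchy_Schwarz_ineq2)
    also have "\<dots> \<le> (a1 * norm (u t)) * (norm (p t) + norm (u t) / a0)"
      using a0 by (intro mult_mono M_bound U_norm t) auto
    finally have "- (norm (p t))\<^sup>2 - inner (M (u t)) (U t) + (norm (u t))\<^sup>2 \<le>
        - (norm (p t))\<^sup>2 + a1 * norm (u t) * (norm (p t) + norm (u t) / a0) + (norm (u t))\<^sup>2"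
      by linarith
    then have "3/2 * \<alpha> * (- (norm (p t))\<^sup>2 - inner (M (u t)) (U t) + (norm (u t))\<^sup>2) \<le>
        3/2 * \<alpha> * (- (norm (p t))\<^sup>2 + a1 * norm (u t) * (norm (p t) + norm (u t) / a0) + (norm (u t))\<^sup>2)"
      using \<alpha> by (intro mult_left_mono) auto
    then have "L' t \<le> - (a0 * (norm (u t))\<^sup>2) +
        3/2 * \<alpha> * (- (norm (p t))\<^sup>2 + a1 * norm (u t) * (norm (p t) + norm (u t) / a0) + (norm (u t))\<^sup>2)"
      using M_coercive[of "u t"] unfolding L'_def by linarith
    also have "\<dots> \<le> - (3/2 * \<alpha> * e t)"
      using lyapunov_dissipation_bound[OF a0, of "norm (u t)" "norm (p t)"]
      by (simp add: e_def \<alpha>_def)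
    \<comment> \<open>Here the factor 3/2 in eps = 3/2 \<alpha> is spent: L <= 3/2 E gives eps E >=
      \<alpha> L.\<close>
    also have "\<dots> \<le> - \<alpha> * L t"
      using mult_left_mono[OF L_bounds(2)[OF t], of \<alpha>] \<alpha> by simp
    finally show ?thesis .
  qed
  \<comment> \<open>The integrating factor turns L' <= - \<alpha> L into monotonicity.\<close>
  have "exp (\<alpha> * t) * L t \<le> exp (\<alpha> * s) * L s"
  proof (rule DERIV_nonpos_imp_decreasing_open[OF st(2)])
    show "continuous_on {s..t} (\<lambda>t. exp (\<alpha> * t) * L t)"
    proof -
      have "continuous_on {0..T} L" using L_deriv by (rule DERIV_continuous_on)
      then have "continuous_on {s..t} L" by (rule continuous_on_subset) (use st in auto)
      then show ?thesis by (intro continuous_intros)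
    qed
    fix r assume r: "s < r" "r < t"
    then have rT: "r \<in> {0..T}" and "r \<in> interior {0..T}" using st by auto
    then have dL: "(L has_real_derivative L' r) (at r)"
      using L_deriv[OF rT] by (metis at_within_interior)
    have "((\<lambda>t. exp (\<alpha> * t)) has_real_derivative exp (\<alpha> * r) * \<alpha>) (at r)"
      by (auto intro!: derivative_eq_intros)
    from DERIV_mult[OF this dL]
    have "((\<lambda>t. exp (\<alpha> * t) * L t) has_real_derivative exp (\<alpha> * r) * (\<alpha> * L r + L' r)) (at r)"
      by (simp add: algebra_simps)
    moreover have "\<alpha> * L r + L' r \<le> 0" using L'_le[OF rT] by linarith
    then have "exp (\<alpha> * r) * (\<alpha> * L r + L' r) \<le> 0" by (intro mult_nonneg_nonpos) auto
    ultimately show "\<exists>y. ((\<lambda>t. exp (\<alpha> * t) * L t) has_real_derivative y) (at r) \<and> y \<le> 0"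
      by (intro exI conjI)
  qed
  then have "exp (- \<alpha> * t) * (exp (\<alpha> * t) * L t) \<le> exp (- \<alpha> * t) * (exp (\<alpha> * s) * L s)"
    by (intro mult_left_mono) auto
  moreover have "exp (- \<alpha> * t) * exp (\<alpha> * t) = 1" "exp (- \<alpha> * t) * exp (\<alpha> * s) = exp (- \<alpha> * (t - s))"
    by (simp_all add: exp_add[symmetric] right_diff_distrib)
  ultimately have "L t \<le> exp (- \<alpha> * (t - s)) * L s"
    by (simp only: mult.assoc[symmetric] mult_1_left)
  also have "\<dots> \<le> exp (- \<alpha> * (t - s)) * (3/2 * e s)"
    by (intro mult_left_mono L_bounds) (use st in auto)
  finally have "L t \<le> exp (- \<alpha> * (t - s)) * (3/2 * e s)" .
  moreover have "e t / 2 \<le> L t" by (rule L_bounds(1)) (use st in auto)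
  \<comment> \<open>The factor is 3 = (3/2) / (1/2), the ratio of the two bounds on
    \<open>L\<close>.\<close>
  ultimately have "e t \<le> 3 * exp (- \<alpha> * (t - s)) * e s" by linarith
  then show ?thesis by (simp only: e_def \<alpha>_def)
qed

text \<open>Tested with a fixed \<open>v\<close>, u has a weak derivative that equals (p, D v) - (M
  u, v) almost everywhere. This is continuous in time, so the scalar function is continuously
  differentiable; sums over \<open>E\<close> and \<open>C\<close> recover u and p.\<close>

lemma weak_solution_imp_solution:
  assumes T: "0 < T" and H1: "H1_time T (V \<times> Q) (\<lambda>t. (u t, p t)) (\<lambda>t. (u' t, p' t))"
    and eqs: "AE t in lebesgue_on {0<..<T}.
        (\<forall>v\<in>V. inner (u' t) v - inner (p t) (D v) + inner (M (u t)) v = 0) \<and>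
        (\<forall>q\<in>Q. inner (p' t) q + inner (D (u t)) q = 0)"
  shows "\<exists>u' p'. solution T u p u' p'"
proof -
  obtain E where E: "finite E" "E \<subseteq> V" "\<And>x. x \<in> V \<Longrightarrow> (\<Sum>e\<in>E. inner x e *\<^sub>R e) = x"
    using finite_dim_orthonormal_expansion[OF V] by blast
  obtain C where C: "finite C" "C \<subseteq> Q" "\<And>x. x \<in> Q \<Longrightarrow> (\<Sum>e\<in>C. inner x e *\<^sub>R e) = x"
    using finite_dim_orthonormal_expansion[OF Q(1)] by blast
  have VQ: "u t \<in> V" "p t \<in> Q" if "t \<in> {0..T}" for t
    using H1 that by (auto simp: H1_time_def)
  have "continuous_on {0..T} (\<lambda>t. (u t, p t))" using H1 by (simp add: H1_time_def)
  from continuous_on_fst[OF this] continuous_on_snd[OF this]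
  have cont: "continuous_on {0..T} u" "continuous_on {0..T} p" by auto
  have weak: "weak_derivative 0 T (\<lambda>t. (u t, p t)) (\<lambda>t. (u' t, p' t))"
    using H1 by (simp add: H1_time_def)
  have DE: "D v = (\<Sum>e\<in>E. inner v e *\<^sub>R D e)" if "v \<in> V" for v
    using D_sum[OF E(1), of "\<lambda>e. e" "inner v"] E(2) E(3)[OF that] by simp
  have contM: "continuous_on {0..T} (\<lambda>t. M (u t))"
    by (rule bounded_linear.continuous_on[OF M_bounded_linear cont(1)])
  \<comment> \<open>\<open>D\<close> is only known to be linear on \<open>V\<close>; the finite
    expansion along \<open>E\<close> makes its composition with u continuous.\<close>
  have "continuous_on {0..T} (\<lambda>t. \<Sum>e\<in>E. inner (u t) e *\<^sub>R D e)"
    by (intro continuous_on_sum continuous_on_scaleR continuous_on_inner continuous_on_const cont(1))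
  then have contD: "continuous_on {0..T} (\<lambda>t. D (u t))"
    by (rule continuous_on_eq) (use VQ DE in auto)
  have du: "((\<lambda>t. inner (u t) v) has_real_derivative inner (p t) (D v) - inner (M (u t)) v) (at t within {0..T})"
    if v: "v \<in> V" and t: "t \<in> {0..T}" for v t
  proof (rule weak_derivative_continuous_imp_DERIV[OF T _ _ _ t])
    have "weak_derivative 0 T (\<lambda>t. inner (u t) v) (\<lambda>t. inner (u' t) v)"
      using weak_derivative_bounded_linear[OF weak bounded_linear_inner_left_comp[OF bounded_linear_fst], of v]
      by simp
    moreover have "AE t in lebesgue_on {0<..<T}. inner (u' t) v = inner (p t) (D v) - inner (M (u t)) v"
      using eqs
    proof eventually_elim
      case (elim t)
      then have "inner (u' t) v - inner (p t) (D v) + inner (M (u t)) v = 0" using v by blast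
      then show ?case by linarith
    qed
    ultimately show "weak_derivative 0 T (\<lambda>t. inner (u t) v) (\<lambda>t. inner (p t) (D v) - inner (M (u t)) v)"
      by (rule weak_derivative_cong_AE_right)
  next
    show "continuous_on {0..T} (\<lambda>t. inner (u t) v)"
      by (rule continuous_on_inner[OF cont(1) continuous_on_const])
    show "continuous_on {0..T} (\<lambda>t. inner (p t) (D v) - inner (M (u t)) v)"
      by (rule continuous_on_diff[OF continuous_on_inner[OF cont(2) continuous_on_const]
            continuous_on_inner[OF contM continuous_on_const]])
  qed
  have dp: "((\<lambda>t. inner (p t) q) has_real_derivative - inner (D (u t)) q) (at t within {0..T})"
    if q: "q \<in> Q" and t: "t \<in> {0..T}" for q t
  proof (rule weak_derivative_continuous_imp_DERIV[OF T _ _ _ t])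
    have "weak_derivative 0 T (\<lambda>t. inner (p t) q) (\<lambda>t. inner (p' t) q)"
      using weak_derivative_bounded_linear[OF weak bounded_linear_inner_left_comp[OF bounded_linear_snd], of q]
      by simp
    moreover have "AE t in lebesgue_on {0<..<T}. inner (p' t) q = - inner (D (u t)) q"
      using eqs
    proof eventually_elim
      case (elim t)
      then have "inner (p' t) q + inner (D (u t)) q = 0" using q by blast
      then show ?case by linarith
    qed
    ultimately show "weak_derivative 0 T (\<lambda>t. inner (p t) q) (\<lambda>t. - inner (D (u t)) q)"
      by (rule weak_derivative_cong_AE_right)
  next
    show "continuous_on {0..T} (\<lambda>t. inner (p t) q)"
      by (rule continuous_on_inner[OF cont(2) continuous_on_const])
    show "continuous_on {0..T} (\<lambda>t. - inner (D (u t)) q)"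
      by (rule continuous_on_minus[OF continuous_on_inner[OF contD continuous_on_const]])
  qed
  \<comment> \<open>\<open>u'\<close> and \<open>p'\<close> are determined only almost everywhere;
    the classical derivatives are defined by the equations at every time.\<close>
  define w where "w t = (\<Sum>e\<in>E. (inner (p t) (D e) - inner (M (u t)) e) *\<^sub>R e)" for t
  define r where "r t = - D (u t)" for t
  have "solution T u p w r"
    unfolding solution_def
  proof (intro ballI conjI)
    fix t assume t: "t \<in> {0..T}"
    show "u t \<in> V" "p t \<in> Q" using VQ t by auto
    show "w t \<in> V"
      unfolding w_def using E(2) by (intro subspace_sum subspace_scale V_subspace) auto
    have "((\<lambda>t. \<Sum>e\<in>E. inner (u t) e *\<^sub>R e) has_vector_derivative w t) (at t within {0..T})"
      unfolding w_def
      by (intro has_vector_derivative_sum bounded_linear.has_vector_derivative[OF bounded_linear_scaleR_left])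
         (use du E(2) t in \<open>auto simp: has_real_derivative_iff_has_vector_derivative[symmetric]\<close>)
    then show "(u has_vector_derivative w t) (at t within {0..T})"
      by (rule has_vector_derivative_transform[OF t, rotated]) (use VQ E(3) in auto)
    have "D (u t) \<in> Q" using VQ t Q(2) by auto
    have "((\<lambda>t. \<Sum>e\<in>C. inner (p t) e *\<^sub>R e) has_vector_derivative
        (\<Sum>e\<in>C. (- inner (D (u t)) e) *\<^sub>R e)) (at t within {0..T})"
      by (intro has_vector_derivative_sum bounded_linear.has_vector_derivative[OF bounded_linear_scaleR_left])
         (use dp C(2) t in \<open>auto simp: has_real_derivative_iff_has_vector_derivative[symmetric]\<close>)
    also have "(\<Sum>e\<in>C. (- inner (D (u t)) e) *\<^sub>R e) = r t"
      using C(3)[OF \<open>D (u t) \<in> Q\<close>] by (simp add: r_def sum_negf)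
    finally show "(p has_vector_derivative r t) (at t within {0..T})"
      by (rule has_vector_derivative_transform[OF t, rotated]) (use VQ C(3) in auto)
    show "r t = - D (u t)" by (simp add: r_def)
    show "inner (w t) v - inner (p t) (D v) + inner (M (u t)) v = 0" if v: "v \<in> V" for v
    proof -
      have "inner (w t) v = (\<Sum>e\<in>E. inner (p t) (D e) * inner e v) - (\<Sum>e\<in>E. inner (M (u t)) e * inner e v)"
        by (simp add: w_def inner_sum_left left_diff_distrib sum_subtractf)
      also have "(\<Sum>e\<in>E. inner (p t) (D e) * inner e v) = inner (p t) (D v)"
        unfolding DE[OF v] by (simp add: inner_sum_right mult.commute inner_commute[of v])
      also have "(\<Sum>e\<in>E. inner (M (u t)) e * inner e v) = inner (M (u t)) (\<Sum>e\<in>E. inner v e *\<^sub>R e)"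
        by (simp add: inner_sum_right mult.commute inner_commute[of v])
      finally show ?thesis using E(3)[OF v] by simp
    qed
  qed
  then show ?thesis by blast
qed

lemma weak_solution_energy_decay:
  assumes "0 < T" "H1_time T (V \<times> Q) (\<lambda>t. (u t, p t)) (\<lambda>t. (u' t, p' t))"
    "AE t in lebesgue_on {0<..<T}.
        (\<forall>v\<in>V. inner (u' t) v - inner (p t) (D v) + inner (M (u t)) v = 0) \<and>
        (\<forall>q\<in>Q. inner (p' t) q + inner (D (u t)) q = 0)"
    "0 \<le> s" "s \<le> t" "t \<le> T"
  shows "((norm (dt T k u t))\<^sup>2 + (norm (dt T k p t))\<^sup>2) / 2 \<le>
    3 * exp (- decay_rate a0 a1 * (t - s)) * (((norm (dt T k u s))\<^sup>2 + (norm (dt T k p s))\<^sup>2) / 2)"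
proof -
  obtain w q where "solution T u p w q" using weak_solution_imp_solution[OF assms(1-3)] by blast
  from solution_dt[OF this assms(1)]
  obtain w q where "solution T (dt T k u) (dt T k p) w q" by blast
  then show ?thesis by (rule solution_energy_decay[OF _ assms(4-6)])
qed

end

section \<open>The Galerkin method in \<open>L\<^sup>2(0,1)\<close>\<close>

lemma ae_eq_rep_L2: "ae_eq (rep_L2 u) (rep_L2 u)"
  by (rule Quotient3_rep_reflp[OF Quotient3_L2])

lemma square_integrable_rep_L2: "square_integrable 0 1 (rep_L2 u)"
  using ae_eq_rep_L2 by (simp add: ae_eq_def)

lemma L2_eqI: "AE x in unit_measure. rep_L2 u x = rep_L2 v x \<Longrightarrow> u = v"
  using Quotient3_rel_rep[OF Quotient3_L2, of u v] square_integrable_rep_L2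
  by (simp add: ae_eq_def)

lemma AE_rep_abs_L2:
  "square_integrable 0 1 f \<Longrightarrow> AE x in unit_measure. rep_L2 (abs_L2 f) x = f x"
  using rep_abs_rsp_left[OF Quotient3_L2, of f f] by (simp add: ae_eq_def)

lemma inner_L2_rep: "inner u v = (LINT x|unit_measure. rep_L2 u x * rep_L2 v x)"
  by (simp add: inner_L2_def)

lemma AE_rep_plus_L2: "AE x in unit_measure. rep_L2 (u + v) x = rep_L2 u x + rep_L2 v x"
  using AE_rep_abs_L2[OF square_integrable_add[OF square_integrable_rep_L2 square_integrable_rep_L2]]
  by (simp add: plus_L2_def)

lemma AE_rep_scaleR_L2: "AE x in unit_measure. rep_L2 (c *\<^sub>R u) x = c * rep_L2 u x"
  using AE_rep_abs_L2[OF square_integrable_scale[OF square_integrable_rep_L2]]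
  by (simp add: scaleR_L2_def)

lemma AE_rep_zero_L2: "AE x in unit_measure. rep_L2 0 x = 0"
  using AE_rep_abs_L2[OF square_integrable_zero] by (simp add: zero_L2_def)

interpretation unit_measure: finite_measure unit_measure
  by (rule finite_measure_Ioo)

lemma integral_const_unit_measure: "(LINT x|unit_measure. c) = (c :: real)"
  by (simp add: space_restrict_space measure_restrict_space)

lemma square_integrable_const: "square_integrable 0 1 (\<lambda>x. c :: real)"
  by (simp add: square_integrable_def)

lemma AE_rep_one_L2: "AE x in unit_measure. rep_L2 one_L2 x = 1"
  using AE_rep_abs_L2[OF square_integrable_const] by (simp add: one_L2_def)

lemma integrable_rep_mult_L2: "integrable unit_measure (\<lambda>x. rep_L2 u x * rep_L2 v x)"
  by (intro square_integrable_mult square_integrable_rep_L2)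

lemma integrable_rep_L2: "integrable unit_measure (rep_L2 u)"
  using square_integrable_mult[OF square_integrable_rep_L2 square_integrable_const[of 1]] by simp

lemma measurable_rep_L2 [measurable]: "rep_L2 u \<in> borel_measurable unit_measure"
  using square_integrable_rep_L2 by (simp add: square_integrable_def)

lemma norm_one_L2: "norm one_L2 = 1"
proof -
  have "inner one_L2 one_L2 = (LINT x|unit_measure. 1)"
    unfolding inner_L2_rep using AE_rep_one_L2 by (intro integral_cong_AE) auto
  then show ?thesis unfolding integral_const_unit_measure by (simp add: norm_eq_sqrt_inner)
qed

section \<open>Weak derivatives of elements of \<open>L2\<close>\<close>

lemma dx_eq: "has_weak_dx v g \<Longrightarrow> dx v = g"
  unfolding dx_def
  by (rule the_equality, assumption)
     (auto simp: has_weak_dx_def intro!: L2_eqI weak_derivative_unique integrable_rep_L2)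

lemma has_weak_dx_dx: "v \<in> H1 \<Longrightarrow> has_weak_dx v (dx v)"
  using dx_eq by (auto simp: H1_def)

lemma has_weak_dx_add:
  assumes "has_weak_dx v g" "has_weak_dx w h" shows "has_weak_dx (v + w) (g + h)"
proof -
  have "weak_derivative 0 1 (\<lambda>x. rep_L2 v x + rep_L2 w x) (\<lambda>x. rep_L2 g x + rep_L2 h x)"
    unfolding weak_derivative_def
  proof (intro allI impI)
    fix \<phi> assume "test_function 0 1 \<phi>"
    then obtain I J where
      "((\<lambda>x. deriv \<phi> x *\<^sub>R rep_L2 v x) has_integral I) {0..1}"
      "((\<lambda>x. \<phi> x *\<^sub>R rep_L2 g x) has_integral - I) {0..1}"
      "((\<lambda>x. deriv \<phi> x *\<^sub>R rep_L2 w x) has_integral J) {0..1}"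
      "((\<lambda>x. \<phi> x *\<^sub>R rep_L2 h x) has_integral - J) {0..1}"
      using assms unfolding has_weak_dx_def weak_derivative_def by blast
    from has_integral_add[OF this(1,3)] has_integral_add[OF this(2,4)]
    show "\<exists>I. ((\<lambda>x. deriv \<phi> x *\<^sub>R (rep_L2 v x + rep_L2 w x)) has_integral I) {0..1} \<and>
        ((\<lambda>x. \<phi> x *\<^sub>R (rep_L2 g x + rep_L2 h x)) has_integral - I) {0..1}"
      by (intro exI[of _ "I + J"]) (simp add: distrib_left)
  qed
  moreover have "AE x in unit_measure. rep_L2 v x + rep_L2 w x = rep_L2 (v + w) x"
    "AE x in unit_measure. rep_L2 g x + rep_L2 h x = rep_L2 (g + h) x"
    by (rule AE_symmetric[OF AE_rep_plus_L2])+
  ultimately show ?thesis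
    unfolding has_weak_dx_def by (rule weak_derivative_cong_AE[rotated 2])
qed

lemma has_weak_dx_scaleR:
  assumes "has_weak_dx v g" shows "has_weak_dx (c *\<^sub>R v) (c *\<^sub>R g)"
proof -
  have "weak_derivative 0 1 (\<lambda>x. c * rep_L2 v x) (\<lambda>x. c * rep_L2 g x)"
    using weak_derivative_bounded_linear[OF _ bounded_linear_mult_right] assms
    by (simp add: has_weak_dx_def)
  moreover have "AE x in unit_measure. c * rep_L2 v x = rep_L2 (c *\<^sub>R v) x"
    "AE x in unit_measure. c * rep_L2 g x = rep_L2 (c *\<^sub>R g) x"
    by (rule AE_symmetric[OF AE_rep_scaleR_L2])+
  ultimately show ?thesis
    unfolding has_weak_dx_def by (rule weak_derivative_cong_AE[rotated 2])
qed

lemma has_weak_dx_one: "has_weak_dx one_L2 0"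
proof -
  have "weak_derivative 0 1 (\<lambda>x. 1::real) (\<lambda>x. 0)"
    unfolding weak_derivative_def
  proof (intro allI impI)
    fix \<phi> assume \<phi>: "test_function 0 1 \<phi>"
    have "(deriv \<phi> has_integral (\<phi> 1 - \<phi> 0)) {0..1}"
      using test_function_DERIV[OF \<phi>]
      by (intro fundamental_theorem_of_calculus)
         (auto intro: has_vector_derivative_at_within simp: has_real_derivative_iff_has_vector_derivative)
    moreover obtain c d where "0 < c" "d < 1" "\<And>x. x \<notin> {c..d} \<Longrightarrow> \<phi> x = 0"
      using \<phi> unfolding test_function_alt by blast
    then have "\<phi> 1 = 0" "\<phi> 0 = 0" by auto
    ultimately show "\<exists>I. ((\<lambda>x. deriv \<phi> x *\<^sub>R 1) has_integral I) {0..1} \<and>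
        ((\<lambda>x. \<phi> x *\<^sub>R (0::real)) has_integral - I) {0..1}"
      by (intro exI[of _ 0]) simp
  qed
  moreover have "AE x in unit_measure. 1 = rep_L2 one_L2 x" "AE x in unit_measure. 0 = rep_L2 0 x"
    by (rule AE_symmetric[OF AE_rep_one_L2], rule AE_symmetric[OF AE_rep_zero_L2])
  ultimately show ?thesis
    unfolding has_weak_dx_def by (rule weak_derivative_cong_AE[rotated 2])
qed

section \<open>Multiplication by the coefficient and the weighted Poincare inequality\<close>

context
  fixes a :: "real \<Rightarrow> real" and a0 a1 :: real
  assumes a_meas [measurable]: "a \<in> borel_measurable unit_measure"
    and a0_pos: "0 < a0"
    and a_bounds: "\<forall>x\<in>{0<..<1}. a0 \<le> a x \<and> a x \<le> a1"
begin

lemma a0_le_a1: "a0 \<le> a1"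
  using a_bounds[rule_format, of "1/2"] by simp

lemma AE_a_bounds: "AE x in unit_measure. a0 \<le> a x \<and> a x \<le> a1"
  using a_bounds by (intro AE_I2) (simp add: space_restrict_space)

lemma a_mult_integrable:
  assumes "integrable unit_measure f" shows "integrable unit_measure (\<lambda>x. a x * f x)"
proof (rule integrable_bounded_mult[OF assms a_meas])
  show "\<bar>a x\<bar> \<le> a1" if "x \<in> space unit_measure" for x
    using a_bounds[rule_format, of x] a0_pos that by (simp add: space_restrict_space)
qed

lemma AE_rep_mult_L2: "AE x in unit_measure. rep_L2 (mult_L2 a u) x = a x * rep_L2 u x"
  unfolding mult_L2_def
proof (rule AE_rep_abs_L2)
  have "integrable unit_measure (\<lambda>x. a x * (a x * (rep_L2 u x * rep_L2 u x)))"
    by (intro a_mult_integrable integrable_rep_mult_L2)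
  then show "square_integrable 0 1 (\<lambda>x. a x * rep_L2 u x)"
    by (simp add: square_integrable_def power2_eq_square mult_ac)
qed

lemma inner_mult_L2: "inner (mult_L2 a u) v = (LINT x|unit_measure. a x * (rep_L2 u x * rep_L2 v x))"
  unfolding inner_L2_rep using AE_rep_mult_L2[of u] by (intro integral_cong_AE) auto

lemma mult_L2_symmetric: "inner (mult_L2 a u) v = inner u (mult_L2 a v)"
  unfolding inner_commute[of u] inner_mult_L2 by (simp add: mult_ac)

lemma mult_L2_coercive: "a0 * (norm u)\<^sup>2 \<le> inner (mult_L2 a u) u"
proof -
  have "a0 * (norm u)\<^sup>2 = (LINT x|unit_measure. a0 * (rep_L2 u x * rep_L2 u x))"
    by (simp add: power2_norm_eq_inner inner_L2_rep)
  also have "\<dots> \<le> inner (mult_L2 a u) u"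
    unfolding inner_mult_L2
  proof (rule integral_mono_AE)
    show "AE x in unit_measure. a0 * (rep_L2 u x * rep_L2 u x) \<le> a x * (rep_L2 u x * rep_L2 u x)"
      using AE_a_bounds by eventually_elim (auto intro: mult_right_mono)
  qed (intro integrable_mult_right a_mult_integrable integrable_rep_mult_L2)+
  finally show ?thesis .
qed

lemma mult_L2_norm_le: "norm (mult_L2 a u) \<le> a1 * norm u"
proof -
  have "(norm (mult_L2 a u))\<^sup>2 = (LINT x|unit_measure. a x * (a x * (rep_L2 u x * rep_L2 u x)))"
    unfolding power2_norm_eq_inner inner_mult_L2
    using AE_rep_mult_L2[of u] by (intro integral_cong_AE) (auto simp: mult_ac)
  also have "\<dots> \<le> (LINT x|unit_measure. a1 * (a1 * (rep_L2 u x * rep_L2 u x)))"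
  proof (rule integral_mono_AE)
    show "AE x in unit_measure. a x * (a x * (rep_L2 u x * rep_L2 u x)) \<le> a1 * (a1 * (rep_L2 u x * rep_L2 u x))"
      using AE_a_bounds by eventually_elim (use a0_pos in \<open>auto intro!: mult_mono\<close>)
  qed (intro integrable_mult_right a_mult_integrable integrable_rep_mult_L2)+
  also have "\<dots> = (a1 * norm u)\<^sup>2"
    by (simp add: power_mult_distrib power2_norm_eq_inner inner_L2_rep power2_eq_square[of a1] mult.assoc)
  finally show ?thesis
    by (rule power2_le_imp_le) (use a0_pos a0_le_a1 in auto)
qed

lemma mult_L2_bounded_linear: "bounded_linear (mult_L2 a)"
proof (rule bounded_linear_intro)
  show "mult_L2 a (u + v) = mult_L2 a u + mult_L2 a v" for u v
    using AE_rep_mult_L2[of u] AE_rep_mult_L2[of v] AE_rep_mult_L2[of "u + v"]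
      AE_rep_plus_L2[of u v] AE_rep_plus_L2[of "mult_L2 a u" "mult_L2 a v"]
    by (intro L2_eqI, eventually_elim) (simp add: distrib_left)
  show "mult_L2 a (c *\<^sub>R u) = c *\<^sub>R mult_L2 a u" for c u
    using AE_rep_mult_L2[of u] AE_rep_mult_L2[of "c *\<^sub>R u"]
      AE_rep_scaleR_L2[of c u] AE_rep_scaleR_L2[of c "mult_L2 a u"]
    by (intro L2_eqI, eventually_elim) simp
  show "norm (mult_L2 a u) \<le> norm u * a1" for u
    using mult_L2_norm_le by (simp add: mult.commute)
qed

text \<open>The interval has measure 1, so the variance of |g| is its mean square minus the square
  of its mean \<open>m\<close>, and it is nonnegative.\<close>

lemma integral_abs_rep_le_norm: "(LINT x|unit_measure. \<bar>rep_L2 g x\<bar>) \<le> norm g"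
proof -
  define m where "m = (LINT x|unit_measure. \<bar>rep_L2 g x\<bar>)"
  have int: "integrable unit_measure (\<lambda>x. \<bar>rep_L2 g x\<bar>)" by (intro integrable_abs integrable_rep_L2)
  have sq: "(\<bar>r\<bar> - m)\<^sup>2 = r * r + (- 2 * m) * \<bar>r\<bar> + m\<^sup>2" for r
    unfolding power2_diff power2_abs by (simp add: power2_eq_square)
  have "0 \<le> (LINT x|unit_measure. (\<bar>rep_L2 g x\<bar> - m)\<^sup>2)" by simp
  also have "\<dots> = (LINT x|unit_measure. rep_L2 g x * rep_L2 g x + (- 2 * m) * \<bar>rep_L2 g x\<bar> + m\<^sup>2)"
    by (simp only: sq)
  also have "\<dots> = (norm g)\<^sup>2 + (- 2 * m) * m + (LINT x|unit_measure. m\<^sup>2)"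
    using int integrable_rep_mult_L2[of g g]
    by (simp add: m_def[symmetric] power2_norm_eq_inner inner_L2_rep del: lebesgue_integral_const)
  also have "(LINT x|unit_measure. m\<^sup>2) = m\<^sup>2" by (rule integral_const_unit_measure)
  finally have "0 \<le> (norm g)\<^sup>2 + (- 2 * m) * m + m\<^sup>2" .
  then have "m\<^sup>2 \<le> (norm g)\<^sup>2" by (simp add: power2_eq_square[of m])
  then have "m \<le> norm g" by (rule power2_le_imp_le) simp
  then show ?thesis by (simp only: m_def)
qed

text \<open>
  The oscillation of \<open>v\<close> is at most \<open>norm g\<close>; comparing \<open>v\<close> with its \<open>a\<close>-weighted mean gives a
  pointwise bound.
\<close>

lemma poincare_L2:
  assumes "has_weak_dx v g"
  shows "norm v \<le> norm g + \<bar>inner (mult_L2 a v) one_L2\<bar> / a0"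
proof -
  define G where "G x = (LINT y|unit_measure. indicator {..<x} y * rep_L2 g y)" for x
  have ig: "integrable unit_measure (\<lambda>y. indicator {..<x} y * rep_L2 g y)" for x
    by (rule indicator_mult_integrable[OF integrable_rep_L2])
  obtain c where c: "AE x in unit_measure. rep_L2 v x = c + G x"
    using weak_derivative_imp_primitive[OF integrable_rep_L2 integrable_rep_L2, of v g] assms
    unfolding has_weak_dx_def G_def by (metis zero_less_one)
  have G_diff: "\<bar>G x - G y\<bar> \<le> norm g" for x y
  proof -
    have "G x - G y = (LINT z|unit_measure. indicator {..<x} z * rep_L2 g z - indicator {..<y} z * rep_L2 g z)"
      using ig by (simp add: G_def)
    also have "\<bar>\<dots>\<bar> \<le> (LINT z|unit_measure. \<bar>indicator {..<x} z * rep_L2 g z - indicator {..<y} z * rep_L2 g z\<bar>)"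
      by (rule integral_abs_bound)
    also have "\<dots> \<le> (LINT z|unit_measure. \<bar>rep_L2 g z\<bar>)"
    proof (rule integral_mono)
      show "integrable unit_measure (\<lambda>z. \<bar>rep_L2 g z\<bar>)" by (intro integrable_abs integrable_rep_L2)
    qed (use ig in \<open>auto simp: indicator_def\<close>)
    also have "\<dots> \<le> norm g" by (rule integral_abs_rep_le_norm)
    finally show ?thesis .
  qed
  have iG: "integrable unit_measure G"
    unfolding G_def[abs_def] by (rule integrable_primitive[OF integrable_rep_L2])
  define A where "A = (LINT y|unit_measure. a y)"
  define I where "I = inner (mult_L2 a v) one_L2"
  have ia: "integrable unit_measure a" using a_mult_integrable[of "\<lambda>x. 1"] by simp
  have A: "a0 \<le> A"
  proof -
    have "(LINT y|unit_measure. a0) \<le> A"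
      unfolding A_def
    proof (rule integral_mono_AE)
      show "AE y in unit_measure. a0 \<le> a y" using AE_a_bounds by eventually_elim simp
    qed (use ia in auto)
    then show ?thesis unfolding integral_const_unit_measure .
  qed
  have I: "I = (LINT y|unit_measure. a y * (c + G y))"
    unfolding I_def inner_mult_L2
    using AE_rep_one_L2 c iG by (intro integral_cong_AE) auto
  \<comment> \<open>Averaging (c + G x) - (c + G y) = G x - G y over y with weight \<open>a\<close>
    compares c + G x with the weighted mean I / A; \<open>G_diff\<close> controls the right-hand
    side.\<close>
  have F_bound: "\<bar>c + G x\<bar> \<le> norm g + \<bar>I\<bar> / a0" for x
  proof -
    have i1: "integrable unit_measure (\<lambda>y. a y * (c + G x))" "integrable unit_measure (\<lambda>y. a y * (c + G y))"
      using a_mult_integrable[of "\<lambda>y. c + G x"] a_mult_integrable[of "\<lambda>y. c + G y"] iG by auto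
    then have "A * (c + G x) - I = (LINT y|unit_measure. a y * (c + G x) - a y * (c + G y))"
      unfolding I A_def using ia by simp
    also have "\<bar>\<dots>\<bar> \<le> (LINT y|unit_measure. \<bar>a y * (c + G x) - a y * (c + G y)\<bar>)"
      by (rule integral_abs_bound)
    also have "\<dots> \<le> (LINT y|unit_measure. a y * norm g)"
    proof (rule integral_mono_AE)
      show "AE y in unit_measure. \<bar>a y * (c + G x) - a y * (c + G y)\<bar> \<le> a y * norm g"
        using AE_a_bounds
      proof eventually_elim
        case (elim y)
        have "\<bar>a y * (c + G x) - a y * (c + G y)\<bar> = a y * \<bar>G x - G y\<bar>"
          using elim a0_pos by (simp add: right_diff_distrib[symmetric] abs_mult)
        also have "\<dots> \<le> a y * norm g"
          using elim a0_pos G_diff by (intro mult_left_mono) auto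
        finally show ?case .
      qed
      show "integrable unit_measure (\<lambda>y. \<bar>a y * (c + G x) - a y * (c + G y)\<bar>)"
        using i1 by (intro integrable_abs Bochner_Integration.integrable_diff)
      show "integrable unit_measure (\<lambda>y. a y * norm g)" using ia by simp
    qed
    also have "\<dots> = A * norm g" using ia by (simp add: A_def)
    finally have "\<bar>A * (c + G x)\<bar> \<le> A * norm g + \<bar>I\<bar>" by linarith
    then have "A * \<bar>c + G x\<bar> \<le> A * norm g + \<bar>I\<bar>" using A a0_pos by (simp add: abs_mult)
    then have "\<bar>c + G x\<bar> \<le> norm g + \<bar>I\<bar> / A" using A a0_pos by (simp add: field_simps)
    moreover have "\<bar>I\<bar> / A \<le> \<bar>I\<bar> / a0" using A a0_pos by (intro divide_left_mono) auto
    ultimately show ?thesis by linarith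
  qed
  \<comment> \<open>On an interval of measure 1 the pointwise bound is also a bound for the
    norm.\<close>
  define K where "K = norm g + \<bar>I\<bar> / a0"
  have K: "0 \<le> K" using a0_pos by (simp add: K_def)
  have "(norm v)\<^sup>2 = (LINT x|unit_measure. rep_L2 v x * rep_L2 v x)"
    by (simp add: power2_norm_eq_inner inner_L2_rep)
  also have "\<dots> \<le> (LINT x|unit_measure. K\<^sup>2)"
  proof (rule integral_mono_AE)
    show "AE x in unit_measure. rep_L2 v x * rep_L2 v x \<le> K\<^sup>2"
      using c
    proof eventually_elim
      case (elim x)
      then have "\<bar>rep_L2 v x\<bar> \<le> \<bar>K\<bar>" using F_bound[of x] K by (simp add: K_def)
      then have "(rep_L2 v x)\<^sup>2 \<le> K\<^sup>2" by (rule abs_le_square_iff[THEN iffD1])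
      then show ?case by (simp add: power2_eq_square)
    qed
  qed (auto intro: integrable_rep_mult_L2)
  also have "\<dots> = K\<^sup>2" by (rule integral_const_unit_measure)
  finally have "norm v \<le> K" by (rule power2_le_imp_le[OF _ K])
  then show ?thesis by (simp add: K_def I_def)
qed

lemma damped_wave_galerkin_L2:
  assumes "finite_dim_subspace V" "V \<subseteq> H1" "finite_dim_subspace Q" "Q = dx ` V" "one_L2 \<in> V"
  shows "damped_wave_galerkin V Q dx (mult_L2 a) one_L2 a0 a1"
proof (rule damped_wave_galerkin.intro)
  have H1: "v \<in> H1" if "v \<in> V" for v using assms(2) that by blast
  show "dx (v + w) = dx v + dx w" if "v \<in> V" "w \<in> V" for v w
    by (intro dx_eq has_weak_dx_add has_weak_dx_dx H1 that)
  show "dx (c *\<^sub>R v) = c *\<^sub>R dx v" if "v \<in> V" for c v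
    by (intro dx_eq has_weak_dx_scaleR has_weak_dx_dx H1 that)
  show "norm v \<le> norm (dx v) + \<bar>inner (mult_L2 a v) one_L2\<bar> / a0" if "v \<in> V" for v
    by (intro poincare_L2 has_weak_dx_dx H1 that)
  show "dx one_L2 = 0" by (rule dx_eq[OF has_weak_dx_one])
qed (rule assms mult_L2_bounded_linear mult_L2_symmetric mult_L2_coercive mult_L2_norm_le
    norm_one_L2 a0_pos a0_le_a1)+

end

theorem theorem5p7:
  fixes a :: "real \<Rightarrow> real" and a0 a1 T :: real
    and V Q :: "L2 set" and u0 p0 :: L2
    and u p u' p' :: "real \<Rightarrow> L2"
  assumes a_meas: "a \<in> borel_measurable (lebesgue_on {0<..<1})"
    and a0_pos: "0 < a0"
    and a_bounds: "\<forall>x\<in>{0<..<1}. a0 \<le> a x \<and> a x \<le> a1"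
    and V: "finite_dim_subspace V" "V \<subseteq> H1"
    and Q: "finite_dim_subspace Q" "Q = dx ` V"
    and one: "one_L2 \<in> V"
    and T: "0 < T"
    and H1: "H1_time T (V \<times> Q) (\<lambda>t. (u t, p t)) (\<lambda>t. (u' t, p' t))"
    and init: "u 0 = orth_proj V u0" "p 0 = orth_proj Q p0"
    and eqs: "AE t in lebesgue_on {0<..<T}.
        (\<forall>v\<in>V. inner (u' t) v - inner (p t) (dx v) + inner (mult_L2 a (u t)) v = 0) \<and>
        (\<forall>q\<in>Q. inner (p' t) q + inner (dx (u t)) q = 0)"
  shows "0 < decay_rate a0 a1 \<and>
    (\<forall>k s t. 0 \<le> s \<and> s \<le> t \<and> t \<le> T \<longrightarrow>
      energy T k u p t \<le> 3 * exp (- decay_rate a0 a1 * (t - s)) * energy T k u p s)"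
proof -
  interpret damped_wave_galerkin V Q dx "mult_L2 a" one_L2 a0 a1
    by (rule damped_wave_galerkin_L2[OF a_meas a0_pos a_bounds V Q one])
  show ?thesis
    using decay_rate_pos[OF a0] weak_solution_energy_decay[OF T H1 eqs]
    by (simp add: energy_def)
qed

end
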